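(* Let $G=\langle a_1,\dots,a_d\rangle\leq \mathrm{Aut}(\mathcal T_d)$ be a spinal Hanoi towers group with root permutations $\sigma_1,\dots,\sigma_d$ and associated permutation group $P=\langle\sigma_1,\dots,\sigma_d\rangle\leq\mathrm{Sym}(d)$. Then: (1) $G$ is fractal and level transitive if and only if $P$ is transitive on $\{1,\dots,d\}$; (2) $G$ is amenable and contracting, with nucleus $\{1\}\cup\{a_i^r\mid 1\leq i\leq d,\ 1\leq r<o(a_i)\}$, and the word problem in $G$ is solvable by an explicit recursion on the syllable length: for every word $\gamma$ in syllable form, the recursive procedure $\mathrm{IsIdentity}(\gamma)$ (described in the context) terminates, and it returns True if and only if $\gamma=1$ in $G$; (3) $G/G'\cong\prod_{i=1}^d\mathbb{Z}/o(a_i)\mathbb{Z}$; (4) $\psi(\mathrm{St}_G(1))\subseteq\left\{(g_1,\ldots,g_d)\in G\times\cdots\times G\ (d\text{ factors})\ \middle|\ \sum_{j=1}^d \varepsilon(g_j)\in \ker(\lambda)\right\}.$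
   Context: Tree and conventions. $\mathcal T_d$ is the $d$-regular rooted tree whose vertices are the finite words over $X=\{1,\dots,d\}$. Automorphisms and permutations act on the right and products are read from left to right. For $g\in\mathrm{Aut}(\mathcal T_d)$ and a vertex $v$, the section $g|_v\in \mathrm{Aut}(\mathcal T_d)$ is defined by $(vw)^g=v^g\,w^{g|_v}$ for all words $w$; thus $(gh)|_v=g|_v\,h|_{v^g}$. We write $\psi(g)=(g|_1,\dots,g|_d)\tau$, where $\tau\in\mathrm{Sym}(d)$ (the root permutation) is the action of $g$ on the first level; $\psi:\mathrm{Aut}(\mathcal T_d)\to \mathrm{Aut}(\mathcal T_d)^d\rtimes\mathrm{Sym}(d)$ is an isomorphism. Spinal Hanoi towers groups. Given $\sigma_1,\dots,\sigma_d\in\mathrm{Sym}(d)$ with $\sigma_i\neq 1$ and $\sigma_i$ fixing $i$ for each $i$, let $a_i\in\mathrm{Aut}(\mathcal T_d)$ be defined recursively by $\psi(a_i)=(1,\dots,1,a_i,1,\dots,1)\sigma_i$, with $a_i$ in the $i$-th coordinate. Any group $G=\langle a_1,\dots,a_d\rangle$ of this form is a spinal Hanoi towers group. Here $o(a_i)$ is the order of $a_i$, which is finite and equals the order of $\sigma_i$. Properties. $\mathrm{St}_G(1)$ is the subgroup of elements of $G$ fixing all vertices of the first level; $\mathrm{st}_G(x)$ is the stabilizer in $G$ of the vertex $x$. A subgroup $G\le\mathrm{Aut}(\mathcal T_d)$ is self-similar if all sections of its elements lie in $G$. A self-similar $G$ is fractal if $\{g|_x: g\in\mathrm{st}_G(x)\}=G$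 for every vertex $x$. $G$ is level transitive if it is transitive on each level $X^n$. A self-similar $G$ is contracting if there is a finite set $\mathcal N\subset G$ such that for every $g\in G$ there is $n_0$ with $g|_v\in\mathcal N$ for all vertices $v$ of length $|v|\ge n_0$; the smallest such $\mathcal N$ is the nucleus. Maps. $\varepsilon:G\to\prod_{i=1}^d\mathbb Z/o(a_i)\mathbb Z$ is the (well-defined) homomorphism sending $a_i$ to the $i$-th standard generator, i.e. the $i$-th coordinate $e_i(g)$ of $\varepsilon(g)$ is the total exponent, modulo $o(a_i)$, of $a_i$ in any word representing $g$; it induces an isomorphism $\overline\varepsilon$ from $G/G'$. $\rho:G\to P$ sends $g$ to its root permutation, and induces $\overline\rho:G/G'\to P/P'$. $\lambda:\prod_{i=1}^d\mathbb Z/o(a_i)\mathbb Z\to P/P'$ is $\lambda=\overline\rho\circ\overline\varepsilon^{-1}$. Syllables and the procedure. A word $\gamma=a_{i_1}^{r_1}\cdots a_{i_k}^{r_k}$ is in syllable form if $1\le r_j<o(a_{i_j})$ for all $j$ and $i_j\ne i_{j+1}$ for all $j<k$; its number of syllables is $k\ge0$. For $x\in X$, the section word $\gamma|_x$ is the product, in increasing order of $t$, of those $a_{i_t}^{r_t}$ such that the image of $x$ under $\sigma_{i_1}^{r_1}\cdots\sigma_{i_{t-1}}^{r_{t-1}}$ is $i_t$, rewritten in syllable form by merging adjacent powers of the same generator, reducing exponents modulo its order, and deleting trivial factors. $\mathrm{IsIdentity}(\gamma)$: if $k=0$ return True; if $k=1$ and $\gamma=a_i^r$, return the truth value of $r\equiv0\pmod{o(a_i)}$;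 otherwise compute $\sigma=\sigma_{i_1}^{r_1}\cdots\sigma_{i_k}^{r_k}$; if $\sigma\neq1$ return False; else return the conjunction of $\mathrm{IsIdentity}(\gamma|_x)$ over $x=1,\dots,d$. *)

theory Defs
  imports "HOL-Algebra.Product_Groups" "HOL-Algebra.Multiplicative_Group"
begin

text \<open>
  The alphabet \<open>X\<close> is a finite type \<open>'x\<close>, so that \<open>d = CARD('x)\<close> and the vertices of the
  \<open>d\<close>-regular rooted tree are all lists over \<open>'x\<close>. Groups act on the right: the image \<open>v\<^sup>g\<close> is
  the application \<open>g v\<close>, and the product of \<open>g\<close> and \<open>h\<close> (first \<open>g\<close>, then \<open>h\<close>) is \<open>h \<circ> g\<close>.
\<close>

definition tree_edge :: "'x list \<Rightarrow> 'x list \<Rightarrow> bool" where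
  "tree_edge u v \<longleftrightarrow> (\<exists>x. v = u @ [x] \<or> u = v @ [x])"

definition tree_Aut :: "('x list \<Rightarrow> 'x list) monoid" where
  "tree_Aut = \<lparr> carrier = {g. bij g \<and> g [] = [] \<and> (\<forall>u v. tree_edge (g u) (g v) \<longleftrightarrow> tree_edge u v)},
                monoid.mult = (\<lambda>g h. h \<circ> g), one = id \<rparr>"

definition Sym :: "('x \<Rightarrow> 'x) monoid" where
  "Sym = \<lparr> carrier = {p. bij p}, monoid.mult = (\<lambda>p q. q \<circ> p), one = id \<rparr>"

text \<open>Automorphisms preserve length and prefixes, so dropping the first \<open>length v\<close> letters of
  \<open>g (v @ w)\<close> yields the section (lemma \<open>sect_eq\<close>).\<close>

definition sect :: "('x list \<Rightarrow> 'x list) \<Rightarrow> 'x list \<Rightarrow> 'x list \<Rightarrow> 'x list" where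
  "sect g v = (\<lambda>w. drop (length v) (g (v @ w)))"

definition root_perm :: "('x list \<Rightarrow> 'x list) \<Rightarrow> 'x \<Rightarrow> 'x" where
  "root_perm g = (\<lambda>x. hd (g [x]))"

definition psi :: "('x list \<Rightarrow> 'x list) \<Rightarrow> ('x \<Rightarrow> 'x list \<Rightarrow> 'x list) \<times> ('x \<Rightarrow> 'x)" where
  "psi g = ((\<lambda>x. sect g [x]), root_perm g)"

lemma tree_Aut_child:
  assumes g: "g \<in> carrier tree_Aut"
  shows "length (g v) = length v \<and> (\<forall>x. \<exists>y. g (v @ [x]) = g v @ [y])"
proof (induction v rule: rev_induct)
  have edge: "tree_edge (g u) (g v) \<longleftrightarrow> tree_edge u v" and "g [] = []" for u v
    using g by (auto simp: tree_Aut_def)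
  then show "length (g []) = length [] \<and> (\<forall>x. \<exists>y. g ([] @ [x]) = g [] @ [y])"
    using edge[of "[]"] by (auto simp: tree_edge_def)
  fix z v
  assume IH: "length (g v) = length v \<and> (\<forall>x. \<exists>y. g (v @ [x]) = g v @ [y])"
  have inj: "inj g"
    using g by (auto simp: tree_Aut_def bij_def)
  obtain y where y: "g (v @ [z]) = g v @ [y]"
    using IH by blast
  have "\<exists>y. g ((v @ [z]) @ [x]) = g (v @ [z]) @ [y]" for x
  proof -
    have "tree_edge (g (v @ [z])) (g ((v @ [z]) @ [x]))"
      using edge tree_edge_def by blast
    moreover have "g (v @ [z]) \<noteq> g ((v @ [z]) @ [x]) @ [y']" for y'
    proof
      assume "g (v @ [z]) = g ((v @ [z]) @ [x]) @ [y']"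
      then have "g v = g ((v @ [z]) @ [x])"
        using y by simp
      then have "v = (v @ [z]) @ [x]"
        using inj by (simp add: inj_eq)
      then show False
        by simp
    qed
    ultimately show ?thesis
      by (auto simp: tree_edge_def)
  qed
  then show "length (g (v @ [z])) = length (v @ [z])
      \<and> (\<forall>x. \<exists>y. g ((v @ [z]) @ [x]) = g (v @ [z]) @ [y])"
    using IH y by simp
qed

lemma sect_eq:
  assumes "g \<in> carrier tree_Aut"
  shows "g (v @ w) = g v @ sect g v w"
proof -
  have "\<exists>w'. g (v @ w) = g v @ w'"
  proof (induction w rule: rev_induct)
    case (snoc x w)
    obtain y where "g ((v @ w) @ [x]) = g (v @ w) @ [y]"
      using tree_Aut_child[OF assms] by blast
    then show ?case
      using snoc by auto
  qed simp
  then show ?thesis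
    using tree_Aut_child[OF assms, of v] by (auto simp: sect_def)
qed

text \<open>The recursive description of the generators by \<open>psi\<close>, unfolded on vertices
  (lemma \<open>psi_hanoi_gen\<close>).\<close>

fun hanoi_gen :: "('x \<Rightarrow> 'x \<Rightarrow> 'x) \<Rightarrow> 'x \<Rightarrow> 'x list \<Rightarrow> 'x list" where
  "hanoi_gen \<sigma> i [] = []"
| "hanoi_gen \<sigma> i (x # w) = \<sigma> i x # (if x = i then hanoi_gen \<sigma> i w else w)"

lemma psi_hanoi_gen:
  "psi (hanoi_gen \<sigma> i) = ((\<lambda>x. if x = i then hanoi_gen \<sigma> i else id), \<sigma> i)"
  by (auto simp: psi_def sect_def root_perm_def fun_eq_iff)

lemma hanoi_gen_in_tree_Aut:
  assumes "bij (\<sigma> i)"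
  shows "hanoi_gen \<sigma> i \<in> carrier tree_Aut"
proof -
  let ?a = "hanoi_gen \<sigma> i"
  have inj: "u = v" if "?a u = ?a v" for u v
    using that
  proof (induction u arbitrary: v)
    case Nil
    then show ?case by (cases v) auto
  next
    case (Cons x u)
    then obtain y v' where "v = y # v'" by (cases v) auto
    with Cons assms show ?case
      by (auto simp: bij_def inj_eq split: if_splits)
  qed
  have surj: "\<exists>u. ?a u = v" for v
  proof (induction v)
    case Nil
    then show ?case by (metis hanoi_gen.simps(1))
  next
    case (Cons y v)
    obtain x where "\<sigma> i x = y" using assms by (metis bij_pointE)
    moreover obtain u where "?a u = v" using Cons by blast
    ultimately have "?a (x # (if x = i then u else v)) = y # v" by simp
    then show ?case by blast
  qed
  have len: "length (?a u) = length u" for u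
    by (induction u) auto
  have child: "\<exists>y. ?a (u @ [x]) = ?a u @ [y]" for u x
    by (induction u) auto
  have edge1: "tree_edge (?a u) (?a v)" if "tree_edge u v" for u v
    using that child[of u] child[of v] unfolding tree_edge_def by blast
  have edge2: "tree_edge u v" if "tree_edge (?a u) (?a v)" for u v
  proof -
    have *: "\<exists>x. v = u @ [x]" if "?a v = ?a u @ [y]" for u v y
    proof -
      have "length v = Suc (length u)"
        using arg_cong[OF that, of length] by (simp add: len)
      then obtain u' x where v: "v = u' @ [x]"
        by (cases v rule: rev_cases) auto
      then have "?a u' = ?a u"
        using child[of u' x] that by auto
      then show ?thesis
        using inj v by blast
    qed
    show ?thesis
      using that *[of v u] *[of u v] unfolding tree_edge_def by blast
  qed
  have "bij ?a"
    using inj surj unfolding bij_def inj_def surj_def by metis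
  then show ?thesis
    using iffI[OF edge2 edge1] by (simp add: tree_Aut_def)
qed

definition hanoi_group :: "('x \<Rightarrow> 'x \<Rightarrow> 'x) \<Rightarrow> ('x list \<Rightarrow> 'x list) monoid" where
  "hanoi_group \<sigma> = subgroup_generated tree_Aut (range (hanoi_gen \<sigma>))"

definition perm_group :: "('x \<Rightarrow> 'x \<Rightarrow> 'x) \<Rightarrow> ('x \<Rightarrow> 'x) monoid" where
  "perm_group \<sigma> = subgroup_generated Sym (range \<sigma>)"

definition gen_ord :: "('x \<Rightarrow> 'x \<Rightarrow> 'x) \<Rightarrow> 'x \<Rightarrow> nat" where
  "gen_ord \<sigma> i = group.ord (hanoi_group \<sigma>) (hanoi_gen \<sigma> i)"

definition transitive_on :: "('a \<Rightarrow> 'a) set \<Rightarrow> 'a set \<Rightarrow> bool" where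
  "transitive_on H A \<longleftrightarrow> (\<forall>x\<in>A. \<forall>y\<in>A. \<exists>g\<in>H. g x = y)"

definition level_transitive :: "('x list \<Rightarrow> 'x list) set \<Rightarrow> bool" where
  "level_transitive H \<longleftrightarrow> (\<forall>n. transitive_on H {v. length v = n})"

definition level_one_stabilizer :: "('x list \<Rightarrow> 'x list) set \<Rightarrow> ('x list \<Rightarrow> 'x list) set" where
  "level_one_stabilizer H = {g \<in> H. \<forall>v. length v = 1 \<longrightarrow> g v = v}"

definition self_similar :: "('x list \<Rightarrow> 'x list) set \<Rightarrow> bool" where
  "self_similar H \<longleftrightarrow> (\<forall>g\<in>H. \<forall>v. sect g v \<in> H)"

definition fractal :: "('x list \<Rightarrow> 'x list) set \<Rightarrow> bool" where
  "fractal H \<longleftrightarrow> self_similar H \<and> (\<forall>v. {sect g v | g. g \<in> H \<and> g v = v} = H)"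

definition contracting_to :: "('x list \<Rightarrow> 'x list) set \<Rightarrow> ('x list \<Rightarrow> 'x list) set \<Rightarrow> bool" where
  "contracting_to H N \<longleftrightarrow>
     finite N \<and> N \<subseteq> H \<and> (\<forall>g\<in>H. \<exists>n\<^sub>0. \<forall>v. n\<^sub>0 \<le> length v \<longrightarrow> sect g v \<in> N)"

definition contracting :: "('x list \<Rightarrow> 'x list) set \<Rightarrow> bool" where
  "contracting H \<longleftrightarrow> self_similar H \<and> (\<exists>N. contracting_to H N)"

definition is_nucleus :: "('x list \<Rightarrow> 'x list) set \<Rightarrow> ('x list \<Rightarrow> 'x list) set \<Rightarrow> bool" where
  "is_nucleus H N \<longleftrightarrow> contracting_to H N \<and> (\<forall>M. contracting_to H M \<longrightarrow> N \<subseteq> M)"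

text \<open>Amenability as a discrete group, in von Neumann's sense: there is a finitely additive
  left-invariant probability measure defined on all subsets.\<close>

definition amenable :: "('a, 'b) monoid_scheme \<Rightarrow> bool" where
  "amenable G \<longleftrightarrow> group G \<and> (\<exists>\<mu> :: 'a set \<Rightarrow> real.
     \<mu> (carrier G) = 1 \<and>
     (\<forall>A. A \<subseteq> carrier G \<longrightarrow> 0 \<le> \<mu> A) \<and>
     (\<forall>A B. A \<subseteq> carrier G \<and> B \<subseteq> carrier G \<and> A \<inter> B = {} \<longrightarrow> \<mu> (A \<union> B) = \<mu> A + \<mu> B) \<and>
     (\<forall>g\<in>carrier G. \<forall>A. A \<subseteq> carrier G \<longrightarrow> \<mu> (g <#\<^bsub>G\<^esub> A) = \<mu> A))"

text \<open>The list \<open>[(i\<^sub>1, r\<^sub>1), \<dots>, (i\<^sub>k, r\<^sub>k)]\<close> stands for the word with the \<open>r\<^sub>t\<close>-th power of the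
  \<open>i\<^sub>t\<close>-th generator as its \<open>t\<close>-th factor.\<close>

type_synonym 'x gword = "('x \<times> int) list"

definition word_eval :: "('a, 'b) monoid_scheme \<Rightarrow> ('x \<Rightarrow> 'a) \<Rightarrow> 'x gword \<Rightarrow> 'a" where
  "word_eval M f \<gamma> = foldr (\<lambda>(i, r) h. (f i [^]\<^bsub>M\<^esub> r) \<otimes>\<^bsub>M\<^esub> h) \<gamma> \<one>\<^bsub>M\<^esub>"

abbreviation word_elem :: "('x \<Rightarrow> 'x \<Rightarrow> 'x) \<Rightarrow> 'x gword \<Rightarrow> 'x list \<Rightarrow> 'x list" where
  "word_elem \<sigma> \<equiv> word_eval (hanoi_group \<sigma>) (hanoi_gen \<sigma>)"

abbreviation word_perm :: "('x \<Rightarrow> 'x \<Rightarrow> 'x) \<Rightarrow> 'x gword \<Rightarrow> 'x \<Rightarrow> 'x" where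
  "word_perm \<sigma> \<equiv> word_eval (perm_group \<sigma>) \<sigma>"

definition syllable_form :: "('x \<Rightarrow> nat) \<Rightarrow> 'x gword \<Rightarrow> bool" where
  "syllable_form m \<gamma> \<longleftrightarrow>
     (\<forall>(i, r)\<in>set \<gamma>. 1 \<le> r \<and> r < int (m i)) \<and> successively (\<lambda>(i, r) (j, s). i \<noteq> j) \<gamma>"

definition add_syllable :: "('x \<Rightarrow> nat) \<Rightarrow> 'x \<Rightarrow> int \<Rightarrow> 'x gword \<Rightarrow> 'x gword" where
  "add_syllable m i r \<gamma> = (if int (m i) dvd r then \<gamma> else (i, r mod int (m i)) # \<gamma>)"

text \<open>Rewriting a word, whose exponents are to be read modulo the orders \<open>m\<close>, in syllable form.\<close>

fun to_syllable_form :: "('x \<Rightarrow> nat) \<Rightarrow> 'x gword \<Rightarrow> 'x gword" where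
  "to_syllable_form m [] = []"
| "to_syllable_form m ((i, r) # \<gamma>) =
     (case to_syllable_form m \<gamma> of
        [] \<Rightarrow> add_syllable m i r []
      | (j, s) # \<delta> \<Rightarrow> if i = j then add_syllable m i (r + s) \<delta>
                     else add_syllable m i r ((j, s) # \<delta>))"

lemma syllable_form_to_syllable_form:
  assumes "\<And>i. m i > 0"
  shows "syllable_form m (to_syllable_form m \<gamma>)"
proof (induction \<gamma>)
  case Nil
  then show ?case by (simp add: syllable_form_def)
next
  case (Cons p \<gamma>)
  obtain i r where p: "p = (i, r)" by (cases p)
  have bd: "1 \<le> s mod int (m j)" "s mod int (m j) < int (m j)" if "\<not> int (m j) dvd s" for j s
  proof -
    have "s mod int (m j) \<noteq> 0" "0 \<le> s mod int (m j)"
      using that assms[of j] by (auto simp: dvd_eq_mod_eq_0)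
    then show "1 \<le> s mod int (m j)"
      by linarith
    show "s mod int (m j) < int (m j)"
      using assms[of j] by simp
  qed
  show ?case
    using Cons bd unfolding p
    by (auto simp: syllable_form_def add_syllable_def successively_Cons split: list.split)
qed

definition section_word :: "('x \<Rightarrow> 'x \<Rightarrow> 'x) \<Rightarrow> 'x gword \<Rightarrow> 'x \<Rightarrow> 'x gword" where
  "section_word \<sigma> \<gamma> x = to_syllable_form (gen_ord \<sigma>)
     [\<gamma> ! t. t \<leftarrow> [0..<length \<gamma>], word_perm \<sigma> (take t \<gamma>) x = fst (\<gamma> ! t)]"

text \<open>The recursion is not proved to terminate here. The domain predicate
  \<open>is_identity_dom\<close> generated by the package says that it terminates on the given input, that
  is, that all chains of recursive calls starting from it are finite.\<close>

function (domintros) is_identity :: "('x \<Rightarrow> 'x \<Rightarrow> 'x) \<Rightarrow> 'x gword \<Rightarrow> bool" where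
  "is_identity \<sigma> \<gamma> =
     (if length \<gamma> = 0 then True
      else if length \<gamma> = 1 then int (gen_ord \<sigma> (fst (hd \<gamma>))) dvd snd (hd \<gamma>)
      else if word_perm \<sigma> \<gamma> \<noteq> id then False
      else (\<forall>x. is_identity \<sigma> (section_word \<sigma> \<gamma> x)))"
  by pat_completeness auto

abbreviation abelianization :: "('a, 'b) monoid_scheme \<Rightarrow> 'a set monoid" where
  "abelianization G \<equiv> G Mod (derived G (carrier G))"

definition exponent_group :: "('x \<Rightarrow> 'x \<Rightarrow> 'x) \<Rightarrow> ('x \<Rightarrow> int) monoid" where
  "exponent_group \<sigma> = product_group UNIV (\<lambda>i. integer_mod_group (gen_ord \<sigma> i))"

definition word_exponents :: "('x \<Rightarrow> 'x \<Rightarrow> 'x) \<Rightarrow> 'x gword \<Rightarrow> 'x \<Rightarrow> int" where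
  "word_exponents \<sigma> \<gamma> = (\<lambda>i. (\<Sum>(j, r)\<leftarrow>\<gamma>. if j = i then r else 0) mod int (gen_ord \<sigma> i))"

text \<open>The common value of \<open>word_exponents\<close> on all words that represent \<open>g\<close>.\<close>

definition eps :: "('x \<Rightarrow> 'x \<Rightarrow> 'x) \<Rightarrow> ('x list \<Rightarrow> 'x list) \<Rightarrow> 'x \<Rightarrow> int" where
  "eps \<sigma> g = (THE e. \<forall>\<gamma>. word_elem \<sigma> \<gamma> = g \<longrightarrow> word_exponents \<sigma> \<gamma> = e)"

text \<open>The maps induced on cosets of the derived subgroup by \<open>eps\<close> and \<open>root_perm\<close>.\<close>

definition eps_bar :: "('x \<Rightarrow> 'x \<Rightarrow> 'x) \<Rightarrow> ('x list \<Rightarrow> 'x list) set \<Rightarrow> 'x \<Rightarrow> int" where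
  "eps_bar \<sigma> C = the_elem (eps \<sigma> ` C)"

definition rho_bar :: "('x \<Rightarrow> 'x \<Rightarrow> 'x) \<Rightarrow> ('x list \<Rightarrow> 'x list) set \<Rightarrow> ('x \<Rightarrow> 'x) set" where
  "rho_bar \<sigma> C = the_elem
     ((\<lambda>g. derived (perm_group \<sigma>) (carrier (perm_group \<sigma>)) #>\<^bsub>perm_group \<sigma>\<^esub> root_perm g) ` C)"

definition lam :: "('x \<Rightarrow> 'x \<Rightarrow> 'x) \<Rightarrow> ('x \<Rightarrow> int) \<Rightarrow> ('x \<Rightarrow> 'x) set" where
  "lam \<sigma> = rho_bar \<sigma> \<circ> inv_into (carrier (abelianization (hanoi_group \<sigma>))) (eps_bar \<sigma>)"

end

theory Submission
  imports
    Defs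
    "HOL-Analysis.Function_Topology"
    "HOL-Analysis.Convex"
    "HOL-Analysis.Infinite_Products"
    "HOL-Combinatorics.Permutations"
    "HOL-Number_Theory.Cong"
begin

text \<open>
  Everything rests on the fact that sections shorten words. A syllable of a word belongs to the section
  at \<open>x\<close> if the preceding syllables carry \<open>x\<close> to its letter \<open>i\<close>. Its root permutation then fixes \<open>i\<close>, so
  the next syllable, which has another letter, belongs to the section at a different point. Each syllable
  belongs to exactly one section, and no two consecutive ones to the same section, so sections of words
  with at least two syllables are strictly shorter (\<open>length_raw_section\<close>). Induction on the number of
  syllables gives contraction, the nucleus and the correctness of the recursive word problem algorithm
  (\<open>sections_eventually_in_nucleus\<close>, \<open>is_identity_correct\<close>).

  The same induction shows that the exponent map is well defined, because the exponents of the sections add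
  up to the exponents of the word (\<open>sum_exponent_raw_section\<close>, \<open>exponent_of_relation\<close>). It is onto, and
  its kernel is the derived subgroup, since in an abelian group the value of a word depends only on its
  exponents (\<open>kernel_eps\<close>). The condition on the first level stabilizer is the additivity of exponents
  again, combined with the triviality of the root permutation (\<open>psi_level_one_stabilizer\<close>).

  If the root permutations act transitively, a letter \<open>x\<close> can be moved to any letter \<open>y\<close> by an element with
  trivial section at \<open>x\<close>: syllables that would contribute to the section do not move the letter and can
  be omitted (\<open>trivial_section_connecting_word\<close>). Moving a letter to \<open>i\<close>, applying \<open>a i\<close>
  and moving back produces every generator, and hence every element of the group, as a section at a
  fixed vertex, which gives fractality and, level by level,
  transitivity.

  For amenability, consider how an element acts near a boundary point of the tree. Away from the
  points with constant tail \<open>i i i \<dots>\<close> it is finitary, and near such a point it acts on the tail as a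
  power of \<open>a i\<close>, its germ there. The germs transform in a simple way under multiplication by a
  generator \<open>a j\<close>: they are permuted along with the points, and the germ at \<open>j j j \<dots>\<close> increases by one.
  A random element is therefore made from independent random germs, uniform at the points \<open>i i i \<dots>\<close>,
  trivial for points of preperiod \<open>n\<close> and interpolated in between, together with a uniformly random
  permutation of a finite level. Since a uniform germ absorbs the increase by one, a generator only
  moves the coordinates around, and only for about \<open>n\<close> coordinates does this change the distribution, by
  about \<open>1 / n\<close> each (\<open>card_preperiod_change\<close>). Affinities of product distributions multiply, so the
  distance of the two joint distributions is of order \<open>1 / sqrt n\<close> (\<open>product_distribution_distance\<close>,
  \<open>weight_move_distance\<close>). The random elements live in a space on which the group acts freely and are
  transported to the group by an equivariant map (\<open>equivariant_retraction\<close>); a limit of their distributions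
  is an invariant mean (\<open>amenableI_approximate_means\<close>). In this way the recurrence of the orbital graphs is
  turned directly into a mean.
\<close>

section \<open>Automorphisms, permutations and words\<close>

lemma tree_Aut_mult [simp]: "g \<otimes>\<^bsub>tree_Aut\<^esub> h = h \<circ> g" and tree_Aut_one [simp]: "\<one>\<^bsub>tree_Aut\<^esub> = id"
  by (simp_all add: tree_Aut_def)

lemma Sym_mult [simp]: "p \<otimes>\<^bsub>Sym\<^esub> q = q \<circ> p" and Sym_one [simp]: "\<one>\<^bsub>Sym\<^esub> = id"
  by (simp_all add: Sym_def)

lemma group_tree_Aut: "group tree_Aut"
proof (rule groupI)
  fix g :: "'x list \<Rightarrow> 'x list" assume g: "g \<in> carrier tree_Aut"
  then have b: "bij g" and g0: "g [] = []"
    by (auto simp: tree_Aut_def)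
  have "tree_edge (inv_into UNIV g u) (inv_into UNIV g v) \<longleftrightarrow> tree_edge u v" for u v
    using g surj_f_inv_f[OF bij_is_surj[OF b]] by (simp add: tree_Aut_def) metis
  moreover have "inv_into UNIV g [] = []"
    using b g0 by (metis bij_is_inj inv_f_f)
  ultimately have "inv_into UNIV g \<in> carrier tree_Aut"
    using b by (auto simp: tree_Aut_def bij_imp_bij_inv)
  moreover have "inv_into UNIV g \<otimes>\<^bsub>tree_Aut\<^esub> g = \<one>\<^bsub>tree_Aut\<^esub>"
    using b by (auto simp: fun_eq_iff bij_is_surj surj_f_inv_f)
  ultimately show "\<exists>h\<in>carrier tree_Aut. h \<otimes>\<^bsub>tree_Aut\<^esub> g = \<one>\<^bsub>tree_Aut\<^esub>"
    by blast
qed (auto simp: tree_Aut_def bij_comp)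

lemma group_Sym: "group Sym"
proof (rule groupI)
  fix p :: "'x \<Rightarrow> 'x" assume "p \<in> carrier Sym"
  then have b: "bij p"
    by (auto simp: Sym_def)
  then have "inv_into UNIV p \<in> carrier Sym" "inv_into UNIV p \<otimes>\<^bsub>Sym\<^esub> p = \<one>\<^bsub>Sym\<^esub>"
    by (auto simp: Sym_def bij_imp_bij_inv fun_eq_iff bij_is_surj surj_f_inv_f)
  then show "\<exists>h\<in>carrier Sym. h \<otimes>\<^bsub>Sym\<^esub> p = \<one>\<^bsub>Sym\<^esub>"
    by blast
qed (auto simp: Sym_def bij_comp)

context group
begin

lemma word_eval_Nil [simp]: "word_eval G f [] = \<one>"
  by (simp add: word_eval_def)

lemma word_eval_Cons [simp]: "word_eval G f ((i, r) # \<gamma>) = f i [^] r \<otimes> word_eval G f \<gamma>"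
  by (simp add: word_eval_def)

lemma word_eval_closed [intro, simp]:
  assumes "\<And>i. f i \<in> carrier G"
  shows "word_eval G f \<gamma> \<in> carrier G"
  by (induction \<gamma>) (auto simp: assms)

lemma word_eval_append:
  assumes "\<And>i. f i \<in> carrier G"
  shows "word_eval G f (\<gamma> @ \<delta>) = word_eval G f \<gamma> \<otimes> word_eval G f \<delta>"
  by (induction \<gamma>) (auto simp: assms m_assoc)

lemma word_eval_inverse:
  assumes "\<And>i. f i \<in> carrier G"
  shows "word_eval G f (rev (map (\<lambda>(i, r). (i, - r)) \<gamma>)) = inv (word_eval G f \<gamma>)"
  by (induction \<gamma>) (auto simp: assms word_eval_append inv_mult_group int_pow_neg)

text \<open>The words with arbitrary integer exponents are closed under concatenation and formal inversion,
  so their values already form the subgroup generated by the letters. Sections and exponents of group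
  elements can therefore be computed on words.\<close>

lemma generate_eq_words:
  assumes "\<And>i. f i \<in> carrier G"
  shows "generate G (range f) = range (word_eval G f)"
proof
  show "generate G (range f) \<subseteq> range (word_eval G f)"
  proof
    fix g assume "g \<in> generate G (range f)"
    then show "g \<in> range (word_eval G f)"
    proof induction
      case one
      show ?case by (metis rangeI word_eval_Nil)
    next
      case (incl h)
      then obtain i where "h = f i" by auto
      then have "h = word_eval G f [(i, 1)]" using assms by simp
      then show ?case by blast
    next
      case (inv h)
      then obtain i where "h = f i" by auto
      then have "inv h = word_eval G f [(i, -1)]" using assms by (simp add: int_pow_neg)
      then show ?case by blast
    next
      case (eng g h)
      then show ?case by (auto simp flip: word_eval_append[OF assms])
    qed
  qed
  have "word_eval G f \<gamma> \<in> generate G (range f)" for \<gamma>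
  proof (induction \<gamma>)
    case Nil
    then show ?case by (simp add: generate.one)
  next
    case (Cons p \<gamma>)
    have "subgroup (generate G (range f)) G"
      using assms by (intro generate_is_subgroup) auto
    then have "f i [^] r \<in> generate G (range f)" for i and r :: int
      using subgroup_int_pow_closed generate.incl by (metis rangeI)
    with Cons show ?case by (cases p) (simp add: generate.eng)
  qed
  then show "range (word_eval G f) \<subseteq> generate G (range f)" by auto
qed

lemma word_eval_subgroup_generated:
  assumes "\<And>i. f i \<in> carrier G"
  shows "word_eval (subgroup_generated G (range f)) f = word_eval G f"
proof -
  have "f i [^]\<^bsub>subgroup_generated G (range f)\<^esub> (r::int) = f i [^] r" for i r
    using assms subgroup_generated_subset_carrier_subset[of "range f"]
    by (intro int_pow_subgroup_generated) blast
  then have "word_eval (subgroup_generated G (range f)) f \<gamma> = word_eval G f \<gamma>" for \<gamma>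
    by (induction \<gamma>) (auto simp: word_eval_def)
  then show ?thesis
    by blast
qed

end

lemma hom_word_eval:
  assumes "group G" "group H" "h \<in> hom G H" "\<And>i. f i \<in> carrier G"
  shows "h (word_eval G f \<gamma>) = word_eval H (h \<circ> f) \<gamma>"
proof -
  interpret group_hom G H h
    using assms by (simp add: group_hom_def group_hom_axioms_def)
  show ?thesis
  proof (induction \<gamma>)
    case (Cons p \<gamma>)
    then show ?case
      using assms(4) G.word_eval_closed[of f \<gamma>] by (cases p) (simp add: hom_int_pow)
  qed simp
qed

text \<open>The unreduced version of \<open>word_exponents\<close>: being exactly additive, it avoids
  modular arithmetic in the inductions.\<close>

definition exponent :: "'x gword \<Rightarrow> 'x \<Rightarrow> int" where
  "exponent \<gamma> i = (\<Sum>(j, r)\<leftarrow>\<gamma>. if j = i then r else 0)"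

lemma exponent_Nil [simp]: "exponent [] i = 0"
  and exponent_Cons [simp]: "exponent ((j, r) # \<gamma>) i = (if j = i then r else 0) + exponent \<gamma> i"
  and exponent_append [simp]: "exponent (\<gamma> @ \<delta>) i = exponent \<gamma> i + exponent \<delta> i"
  by (simp_all add: exponent_def)

lemma exponent_inverse [simp]: "exponent (rev (map (\<lambda>(i, r). (i, - r)) \<gamma>)) k = - exponent \<gamma> k"
  by (induction \<gamma>) auto

lemma word_exponents_eq: "word_exponents \<sigma> \<gamma> i = exponent \<gamma> i mod int (gen_ord \<sigma> i)"
  by (simp add: word_exponents_def exponent_def)

text \<open>In an abelian group the value of a word depends only on the exponents of its letters. Applied to
  the abelianization, this bounds the kernel of the exponent map from above.\<close>

lemma (in comm_group) word_eval_eq_finprod: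
  fixes f :: "'x::finite \<Rightarrow> 'a"
  assumes f: "\<And>i. f i \<in> carrier G"
  shows "word_eval G f \<gamma> = (\<Otimes>i\<in>UNIV. f i [^] exponent \<gamma> i)"
proof (induction \<gamma>)
  case Nil
  then show ?case by simp
next
  case (Cons p \<gamma>)
  obtain i r where p: "p = (i, r)" by (cases p)
  have "(\<Otimes>k\<in>UNIV. f k [^] exponent (p # \<gamma>) k)
      = (\<Otimes>k\<in>UNIV. (if i = k then f k [^] r else \<one>) \<otimes> f k [^] exponent \<gamma> k)"
    unfolding p using f by (intro finprod_cong) (auto simp: int_pow_mult simp_implies_def)
  also have "\<dots> = (\<Otimes>k\<in>UNIV. if i = k then f k [^] r else \<one>) \<otimes> (\<Otimes>k\<in>UNIV. f k [^] exponent \<gamma> k)"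
    using f by (intro finprod_multf) auto
  also have "(\<Otimes>k\<in>UNIV. if i = k then f k [^] r else \<one>) = f i [^] r"
    using f by (intro finprod_singleton) auto
  finally show ?case
    unfolding p by (simp add: Cons)
qed

section \<open>The syllable calculus\<close>

text \<open>The letters of a section word before they are merged into syllables. The recursion follows the
  position of \<open>x\<close> along the word; it replaces the prefix products in the definition of
  \<open>section_word\<close> (lemma \<open>section_word_eq\<close>).\<close>

fun raw_section :: "('x \<Rightarrow> 'x \<Rightarrow> 'x) \<Rightarrow> 'x gword \<Rightarrow> 'x \<Rightarrow> 'x gword" where
  "raw_section \<sigma> [] x = []"
| "raw_section \<sigma> ((i, r) # \<gamma>) x =
     (if x = i then [(i, r)] else []) @ raw_section \<sigma> \<gamma> ((\<sigma> i [^]\<^bsub>perm_group \<sigma>\<^esub> r) x)"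

text \<open>The source of all contraction. If a syllable \<open>(i, r)\<close> is picked for \<open>x\<close>, then \<open>x\<close> has been moved
  to \<open>i\<close>, and it stays there because the power of \<open>\<sigma> i\<close> fixes \<open>i\<close>. The next syllable belongs to
  another letter, so it is not picked. Hence no two consecutive syllables enter the same section,
  and a section has about half the length. The case distinction on the first letter is what makes
  the induction go through.\<close>

lemma length_raw_section:
  assumes "\<And>i (r::int). (\<sigma> i [^]\<^bsub>perm_group \<sigma>\<^esub> r) i = i"
    and "successively (\<lambda>(i, r) (j, s). i \<noteq> j) \<gamma>"
  shows "length (raw_section \<sigma> \<gamma> x) \<le>
    (if \<gamma> \<noteq> [] \<and> fst (hd \<gamma>) = x then (length \<gamma> + 1) div 2 else length \<gamma> div 2)"
  using assms(2)
proof (induction \<gamma> arbitrary: x)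
  case (Cons p \<gamma>)
  obtain i r where p: "p = (i, r)" by (cases p)
  have s: "successively (\<lambda>(i, r) (j, s). i \<noteq> j) \<gamma>" "\<gamma> \<noteq> [] \<Longrightarrow> fst (hd \<gamma>) \<noteq> i"
    using Cons.prems by (auto simp: p successively_Cons)
  show ?case
  proof (cases "x = i")
    case True
    then show ?thesis
      using Cons.IH[OF s(1), of i] s(2) by (auto simp: p assms(1) split: if_splits)
  next
    case False
    then show ?thesis
      using Cons.IH[OF s(1), of "(\<sigma> i [^]\<^bsub>perm_group \<sigma>\<^esub> r) x"] by (auto simp: p split: if_splits)
  qed
qed simp

lemma length_to_syllable_form: "length (to_syllable_form m \<gamma>) \<le> length \<gamma>"
proof (induction \<gamma>)
  case (Cons p \<gamma>)
  then show ?case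
    by (cases p) (auto simp: add_syllable_def split: list.split)
qed simp

lemma exponent_to_syllable_form:
  "exponent (to_syllable_form m \<gamma>) i mod int (m i) = exponent \<gamma> i mod int (m i)"
proof (induction \<gamma>)
  case (Cons p \<gamma>)
  obtain j r where p: "p = (j, r)" by (cases p)
  have add: "exponent (add_syllable m j r \<delta>) i mod int (m i)
      = ((if j = i then r else 0) + exponent \<delta> i) mod int (m i)" for j r \<delta>
    by (auto simp: add_syllable_def mod_simps elim!: dvdE)
  have "exponent (to_syllable_form m (p # \<gamma>)) i mod int (m i)
      = ((if j = i then r else 0) + exponent (to_syllable_form m \<gamma>) i) mod int (m i)"
    by (auto simp: p add add.assoc split: list.split)
  also have "\<dots> = ((if j = i then r else 0) + exponent \<gamma> i) mod int (m i)"
    by (metis Cons mod_add_right_eq)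
  finally show ?case by (simp add: p)
qed simp

locale spinal_hanoi =
  fixes \<sigma> :: "'x::finite \<Rightarrow> 'x \<Rightarrow> 'x"
  assumes bij_\<sigma>: "bij (\<sigma> i)" and \<sigma>_fixes: "\<sigma> i i = i"
begin

abbreviation "G \<equiv> hanoi_group \<sigma>"
abbreviation "P \<equiv> perm_group \<sigma>"
abbreviation "a \<equiv> hanoi_gen \<sigma>"

sublocale G: group G
  unfolding hanoi_group_def by (intro group.group_subgroup_generated group_tree_Aut)

sublocale P: group P
  unfolding perm_group_def by (intro group.group_subgroup_generated group_Sym)

lemma G_mult [simp]: "g \<otimes>\<^bsub>G\<^esub> h = h \<circ> g" and G_one [simp]: "\<one>\<^bsub>G\<^esub> = id"
  by (simp_all add: hanoi_group_def)

lemma P_mult [simp]: "p \<otimes>\<^bsub>P\<^esub> q = q \<circ> p" and P_one [simp]: "\<one>\<^bsub>P\<^esub> = id"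
  by (simp_all add: perm_group_def)

lemma a_in_tree_Aut: "a i \<in> carrier tree_Aut"
  using bij_\<sigma> by (rule hanoi_gen_in_tree_Aut)

lemma \<sigma>_in_Sym: "\<sigma> i \<in> carrier Sym"
  using bij_\<sigma> by (simp add: Sym_def)

lemma carrier_G_words: "carrier G = range (word_elem \<sigma>)"
  unfolding hanoi_group_def
  using a_in_tree_Aut by (simp add: carrier_subgroup_generated Int_absorb1 image_subset_iff
      group.generate_eq_words[OF group_tree_Aut] group.word_eval_subgroup_generated[OF group_tree_Aut])

lemma carrier_P_words: "carrier P = range (word_perm \<sigma>)"
  unfolding perm_group_def
  using \<sigma>_in_Sym by (simp add: carrier_subgroup_generated Int_absorb1 image_subset_iff
      group.generate_eq_words[OF group_Sym] group.word_eval_subgroup_generated[OF group_Sym])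

lemma carrier_G_subset: "carrier G \<subseteq> carrier tree_Aut"
  unfolding hanoi_group_def by (rule group.carrier_subgroup_generated_subset[OF group_tree_Aut])

lemma carrier_P_subset: "carrier P \<subseteq> carrier Sym"
  unfolding perm_group_def by (rule group.carrier_subgroup_generated_subset[OF group_Sym])

lemma a_in_G [simp]: "a i \<in> carrier G"
  unfolding hanoi_group_def
  using group.subgroup_generated_subset_carrier_subset[OF group_tree_Aut, of "range a"] a_in_tree_Aut
  by blast

lemma \<sigma>_in_P [simp]: "\<sigma> i \<in> carrier P"
  unfolding perm_group_def
  using group.subgroup_generated_subset_carrier_subset[OF group_Sym, of "range \<sigma>"] \<sigma>_in_Sym
  by blast

lemma bij_G: "g \<in> carrier G \<Longrightarrow> bij g"
  using carrier_G_subset by (auto simp: tree_Aut_def)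

lemma bij_P: "p \<in> carrier P \<Longrightarrow> bij p"
  using carrier_P_subset by (auto simp: Sym_def)

lemma length_G: "g \<in> carrier G \<Longrightarrow> length (g v) = length v"
  using carrier_G_subset tree_Aut_child by blast

lemma \<sigma>_pow_fixes: "(\<sigma> i [^]\<^bsub>P\<^esub> (n::nat)) i = i"
  by (induction n) (simp_all add: \<sigma>_fixes)

lemma pow_Nil: "(a i [^]\<^bsub>G\<^esub> (n::nat)) [] = []"
  by (induction n) simp_all

text \<open>The powers of a generator have the same recursive form as the generator itself. The point is that
  a power of \<open>\<sigma> i\<close> maps only \<open>i\<close> to \<open>i\<close>, so the copy of \<open>a i\<close> below \<open>i\<close> keeps being met at the
  vertex \<open>i\<close> and nowhere else.\<close>

lemma pow_Cons:
  "(a i [^]\<^bsub>G\<^esub> (n::nat)) (x # w) = (\<sigma> i [^]\<^bsub>P\<^esub> n) x # (if x = i then (a i [^]\<^bsub>G\<^esub> n) w else w)"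
proof (induction n)
  case (Suc n)
  have "bij (\<sigma> i [^]\<^bsub>P\<^esub> n)"
    using bij_P by simp
  then have "(\<sigma> i [^]\<^bsub>P\<^esub> n) x = i \<longleftrightarrow> x = i"
    using \<sigma>_pow_fixes[of i n] by (metis bij_is_inj inj_eq)
  then show ?case
    by (simp add: Suc)
qed simp

text \<open>By \<open>pow_Cons\<close>, every exponent that kills \<open>\<sigma> i\<close> also kills \<open>a i\<close>, and the order of the
  symmetric group kills every \<open>\<sigma> i\<close>. A common exponent
  for all letters reduces negative powers to positive ones and serves as the modulus of the random
  configurations in the proof of amenability.\<close>

lemma common_order: "\<exists>m::nat. m > 0 \<and> (\<forall>i. \<sigma> i [^]\<^bsub>P\<^esub> m = id) \<and> (\<forall>i. a i [^]\<^bsub>G\<^esub> m = id)"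
proof (intro exI[of _ "order Sym"] conjI allI)
  interpret S: group "Sym :: ('x \<Rightarrow> 'x) monoid" by (rule group_Sym)
  show "order (Sym :: ('x \<Rightarrow> 'x) monoid) > 0"
    by (simp add: S.order_gt_0_iff_finite)
  show \<sigma>: "\<sigma> i [^]\<^bsub>P\<^esub> order (Sym :: ('x \<Rightarrow> 'x) monoid) = id" for i
    using S.pow_order_eq_1[OF \<sigma>_in_Sym] by (simp add: perm_group_def pow_subgroup_generated)
  fix i
  have "(a i [^]\<^bsub>G\<^esub> order (Sym :: ('x \<Rightarrow> 'x) monoid)) w = w" for w
    by (induction w) (simp_all add: pow_Nil pow_Cons \<sigma>)
  then show "a i [^]\<^bsub>G\<^esub> order (Sym :: ('x \<Rightarrow> 'x) monoid) = id"
    by auto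
qed

lemma gen_ord_pos: "gen_ord \<sigma> i > 0"
proof -
  obtain m :: nat where "m > 0" "a i [^]\<^bsub>G\<^esub> m = id"
    using common_order by blast
  then show ?thesis
    unfolding gen_ord_def using G.pow_eq_id[OF a_in_G, of i m] by (auto intro: Nat.gr0I)
qed

lemma int_pow_eq_id_iff: "a i [^]\<^bsub>G\<^esub> (r::int) = id \<longleftrightarrow> int (gen_ord \<sigma> i) dvd r"
  using G.int_pow_eq_id[OF a_in_G] by (simp add: gen_ord_def)

lemma int_pow_mod: "a i [^]\<^bsub>G\<^esub> (r mod int (gen_ord \<sigma> i)) = a i [^]\<^bsub>G\<^esub> r"
  using G.int_pow_eq[OF a_in_G] by (simp add: gen_ord_def mod_eq_dvd_iff flip: minus_mod_eq_mult_div)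

lemma int_pow_as_nat_pow:
  obtains n :: nat where "a i [^]\<^bsub>G\<^esub> (r::int) = a i [^]\<^bsub>G\<^esub> n" "\<sigma> i [^]\<^bsub>P\<^esub> r = \<sigma> i [^]\<^bsub>P\<^esub> n"
proof -
  obtain m :: nat where m: "m > 0" "a i [^]\<^bsub>G\<^esub> m = id" "\<sigma> i [^]\<^bsub>P\<^esub> m = id"
    using common_order by blast
  define n where "n = nat (r mod int m)"
  have n: "int n = r mod int m"
    using m(1) by (simp add: n_def)
  have *: "int k dvd r - int n" if "k dvd m" for k
    using that unfolding n minus_mod_eq_mult_div by (meson dvd_mult2 int_dvd_int_iff)
  show thesis
  proof (rule that[of n])
    show "a i [^]\<^bsub>G\<^esub> r = a i [^]\<^bsub>G\<^esub> n"
      using *[of "G.ord (a i)"] m(2) G.pow_eq_id[OF a_in_G] G.int_pow_eq[OF a_in_G]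
      by (simp add: dvd_diff_commute flip: int_pow_int)
    show "\<sigma> i [^]\<^bsub>P\<^esub> r = \<sigma> i [^]\<^bsub>P\<^esub> n"
      using *[of "P.ord (\<sigma> i)"] m(3) P.pow_eq_id[OF \<sigma>_in_P] P.int_pow_eq[OF \<sigma>_in_P]
      by (simp add: dvd_diff_commute flip: int_pow_int)
  qed
qed

lemma int_pow_Cons:
  "(a i [^]\<^bsub>G\<^esub> (r::int)) (x # w) = (\<sigma> i [^]\<^bsub>P\<^esub> r) x # (if x = i then (a i [^]\<^bsub>G\<^esub> r) w else w)"
  by (rule int_pow_as_nat_pow[of i r]) (simp add: pow_Cons)

lemma \<sigma>_int_pow_fixes [simp]: "(\<sigma> i [^]\<^bsub>P\<^esub> (r::int)) i = i"
  by (rule int_pow_as_nat_pow[of i r]) (simp add: \<sigma>_pow_fixes)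

text \<open>The wreath recursion on words: \<open>word_perm\<close> gives the root permutation, \<open>raw_section\<close> the
  first-level sections.\<close>

lemma word_elem_Cons:
  "word_elem \<sigma> \<gamma> (x # w) = word_perm \<sigma> \<gamma> x # word_elem \<sigma> (raw_section \<sigma> \<gamma> x) w"
proof (induction \<gamma> arbitrary: x w)
  case (Cons p \<gamma>)
  then show ?case
    by (cases p) (simp add: int_pow_Cons)
qed simp

lemma word_elem_Nil: "word_elem \<sigma> \<gamma> [] = []"
  using length_G[of "word_elem \<sigma> \<gamma>" "[]"] by simp

lemma word_elem_to_syllable_form:
  "word_elem \<sigma> (to_syllable_form (gen_ord \<sigma>) \<gamma>) = word_elem \<sigma> \<gamma>"
proof (induction \<gamma>)
  case (Cons p \<gamma>)
  obtain i r where p: "p = (i, r)" by (cases p)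
  have add: "word_elem \<sigma> (add_syllable (gen_ord \<sigma>) i r \<delta>) = word_elem \<sigma> \<delta> \<circ> a i [^]\<^bsub>G\<^esub> r" for r \<delta>
    by (auto simp: add_syllable_def int_pow_eq_id_iff[symmetric] int_pow_mod)
  have "word_elem \<sigma> (to_syllable_form (gen_ord \<sigma>) (p # \<gamma>))
     = word_elem \<sigma> (to_syllable_form (gen_ord \<sigma>) \<gamma>) \<circ> a i [^]\<^bsub>G\<^esub> r"
    using G.int_pow_mult[OF a_in_G, of i]
    by (auto simp: p add comp_assoc split: list.split)
  then show ?case by (simp add: p Cons)
qed simp

lemma section_word_eq: "section_word \<sigma> \<gamma> x = to_syllable_form (gen_ord \<sigma>) (raw_section \<sigma> \<gamma> x)"
proof -
  have "[\<gamma> ! t. t \<leftarrow> [0..<length \<gamma>], word_perm \<sigma> (take t \<gamma>) x = fst (\<gamma> ! t)] = raw_section \<sigma> \<gamma> x"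
  proof (induction \<gamma> arbitrary: x)
    case (Cons p \<gamma>)
    obtain i r where p: "p = (i, r)" by (cases p)
    have "[0..<length (p # \<gamma>)] = 0 # map Suc [0..<length \<gamma>]"
      by (simp add: map_Suc_upt upt_conv_Cons del: upt_Suc)
    then have "[(p # \<gamma>) ! t. t \<leftarrow> [0..<length (p # \<gamma>)], word_perm \<sigma> (take t (p # \<gamma>)) x = fst ((p # \<gamma>) ! t)]
      = (if x = i then [(i, r)] else [])
        @ [\<gamma> ! t. t \<leftarrow> [0..<length \<gamma>], word_perm \<sigma> (take t \<gamma>) ((\<sigma> i [^]\<^bsub>P\<^esub> r) x) = fst (\<gamma> ! t)]"
      unfolding p by (simp add: comp_def del: upt_Suc cong: if_cong)
    then show ?case
      unfolding Cons by (simp add: p)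
  qed simp
  then show ?thesis
    by (simp add: section_word_def)
qed

section \<open>Contraction and the word problem\<close>

lemma syllable_form_section_word: "syllable_form (gen_ord \<sigma>) (section_word \<sigma> \<gamma> x)"
  unfolding section_word_eq using gen_ord_pos by (rule syllable_form_to_syllable_form)

lemma raw_section_shorter:
  assumes "syllable_form (gen_ord \<sigma>) \<gamma>" "2 \<le> length \<gamma>"
  shows "length (raw_section \<sigma> \<gamma> x) < length \<gamma>"
  using length_raw_section[of \<sigma> \<gamma> x] assms by (auto simp: syllable_form_def split: if_splits)

lemma section_word_shorter:
  assumes "syllable_form (gen_ord \<sigma>) \<gamma>" "2 \<le> length \<gamma>"
  shows "length (section_word \<sigma> \<gamma> x) < length \<gamma>"
  unfolding section_word_eq
  by (rule le_less_trans[OF length_to_syllable_form raw_section_shorter[OF assms]])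

lemma word_elem_section_word: "word_elem \<sigma> (section_word \<sigma> \<gamma> x) = word_elem \<sigma> (raw_section \<sigma> \<gamma> x)"
  by (simp add: section_word_eq word_elem_to_syllable_form)

lemma word_elem_eq_id_iff:
  "word_elem \<sigma> \<gamma> = id \<longleftrightarrow> word_perm \<sigma> \<gamma> = id \<and> (\<forall>x. word_elem \<sigma> (raw_section \<sigma> \<gamma> x) = id)"
proof
  assume *: "word_perm \<sigma> \<gamma> = id \<and> (\<forall>x. word_elem \<sigma> (raw_section \<sigma> \<gamma> x) = id)"
  have "word_elem \<sigma> \<gamma> v = v" for v
    using * by (cases v) (simp_all add: word_elem_Nil word_elem_Cons)
  then show "word_elem \<sigma> \<gamma> = id" by auto
next
  assume id: "word_elem \<sigma> \<gamma> = id"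
  have "word_perm \<sigma> \<gamma> x # word_elem \<sigma> (raw_section \<sigma> \<gamma> x) w = x # w" for x w
    using word_elem_Cons[of \<gamma> x w] by (simp add: id)
  then show "word_perm \<sigma> \<gamma> = id \<and> (\<forall>x. word_elem \<sigma> (raw_section \<sigma> \<gamma> x) = id)"
    by (simp add: fun_eq_iff)
qed

text \<open>The recursion ends because each call is on a shorter word, and it decides triviality because an
  element is trivial exactly when its root permutation and all first-level sections are. For words
  of one syllable there is nothing to recurse on: \<open>(a i) ^ r\<close> reproduces itself as its own section at
  \<open>i\<close>, and its order decides.\<close>

theorem is_identity_correct:
  assumes "syllable_form (gen_ord \<sigma>) \<gamma>"
  shows "is_identity_dom (\<sigma>, \<gamma>) \<and> (is_identity \<sigma> \<gamma> \<longleftrightarrow> word_elem \<sigma> \<gamma> = id)"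
  using assms
proof (induction "length \<gamma>" arbitrary: \<gamma> rule: less_induct)
  case less
  have rec: "is_identity_dom (\<sigma>, section_word \<sigma> \<gamma> x)"
    "is_identity \<sigma> (section_word \<sigma> \<gamma> x) \<longleftrightarrow> word_elem \<sigma> (raw_section \<sigma> \<gamma> x) = id"
    if "length \<gamma> \<noteq> 0" "length \<gamma> \<noteq> 1" for x
    using less.hyps[OF section_word_shorter syllable_form_section_word, of x] less.prems that
    by (auto simp: word_elem_section_word)
  have dom: "is_identity_dom (\<sigma>, \<gamma>)"
    by (rule is_identity.domintros) (use rec in auto)
  consider "\<gamma> = []" | i r where "\<gamma> = [(i, r)]" | "length \<gamma> \<noteq> 0" "length \<gamma> \<noteq> 1"
    by (cases \<gamma> rule: remdups_adj.cases) auto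
  then have "is_identity \<sigma> \<gamma> \<longleftrightarrow> word_elem \<sigma> \<gamma> = id"
  proof cases
    case 1
    then show ?thesis using is_identity.psimps[OF dom] by simp
  next
    case 2
    then show ?thesis using is_identity.psimps[OF dom] by (simp add: int_pow_eq_id_iff)
  next
    case 3
    then show ?thesis
      using is_identity.psimps[OF dom] rec by (simp add: word_elem_eq_id_iff[of \<gamma>])
  qed
  with dom show ?case by simp
qed

lemma sect_Nil: "sect g [] = g"
  by (simp add: sect_def)

lemma sect_word_elem_Cons:
  "sect (word_elem \<sigma> \<gamma>) (x # v) = sect (word_elem \<sigma> (raw_section \<sigma> \<gamma> x)) v"
  by (simp add: sect_def word_elem_Cons)

lemma sect_word_elem_singleton: "sect (word_elem \<sigma> \<gamma>) [x] = word_elem \<sigma> (raw_section \<sigma> \<gamma> x)"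
  by (simp add: sect_word_elem_Cons sect_Nil)

lemma self_similar_G: "self_similar (carrier G)"
proof -
  have "sect (word_elem \<sigma> \<gamma>) v \<in> carrier G" for \<gamma> v
    by (induction v arbitrary: \<gamma>) (simp_all add: sect_Nil sect_word_elem_Cons)
  then show ?thesis
    by (auto simp: self_similar_def carrier_G_words)
qed

definition nucleus :: "('x list \<Rightarrow> 'x list) set" where
  "nucleus = {id} \<union> {a i [^]\<^bsub>G\<^esub> r | i (r::nat). 1 \<le> r \<and> r < gen_ord \<sigma> i}"

text \<open>Words of at most one syllable represent exactly the elements of the nucleus, and each of their
  first-level sections is either the same word or empty.\<close>

lemma sect_short_word_in_nucleus:
  assumes "syllable_form (gen_ord \<sigma>) \<gamma>" "length \<gamma> < 2"
  shows "sect (word_elem \<sigma> \<gamma>) v \<in> nucleus"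
  using assms
proof (induction v arbitrary: \<gamma>)
  case Nil
  show ?case
  proof (cases \<gamma>)
    case (Cons p \<delta>)
    then obtain i r where \<gamma>: "\<gamma> = [(i, r)]" using Nil.prems by (cases p) auto
    then have "1 \<le> r" "r < int (gen_ord \<sigma> i)"
      using Nil.prems by (auto simp: syllable_form_def)
    moreover from this have "a i [^]\<^bsub>G\<^esub> r = a i [^]\<^bsub>G\<^esub> nat r"
      by (metis int_nat_eq int_pow_int less_le_not_le zero_le_one order_trans)
    ultimately show ?thesis
      unfolding nucleus_def \<gamma> by (auto simp: sect_Nil intro!: exI[of _ i] exI[of _ "nat r"])
  qed (simp add: nucleus_def sect_Nil id_def)
next
  case (Cons x v)
  have "raw_section \<sigma> \<gamma> x = \<gamma> \<or> raw_section \<sigma> \<gamma> x = []"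
    using Cons.prems(2) by (cases \<gamma> rule: remdups_adj.cases) (auto split: if_splits)
  moreover have "syllable_form (gen_ord \<sigma>) []"
    by (simp add: syllable_form_def)
  ultimately show ?case
    unfolding sect_word_elem_Cons using Cons by fastforce
qed

text \<open>Since sections of longer words are shorter, finitely many levels suffice to reach at most one
  syllable.\<close>

lemma sections_eventually_in_nucleus:
  assumes "syllable_form (gen_ord \<sigma>) \<gamma>"
  shows "\<exists>n. \<forall>v. n \<le> length v \<longrightarrow> sect (word_elem \<sigma> \<gamma>) v \<in> nucleus"
  using assms
proof (induction "length \<gamma>" arbitrary: \<gamma> rule: less_induct)
  case less
  show ?case
  proof (cases "length \<gamma> < 2")
    case True
    then show ?thesis using sect_short_word_in_nucleus less.prems by blast
  next
    case False
    then have "\<exists>n. \<forall>v. n \<le> length v \<longrightarrow> sect (word_elem \<sigma> (section_word \<sigma> \<gamma> x)) v \<in> nucleus" for x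
      using less section_word_shorter syllable_form_section_word by simp
    then obtain n where n: "\<And>x v. n x \<le> length v \<Longrightarrow> sect (word_elem \<sigma> (section_word \<sigma> \<gamma> x)) v \<in> nucleus"
      by metis
    have "sect (word_elem \<sigma> \<gamma>) v \<in> nucleus" if v: "Suc (Max (range n)) \<le> length v" for v
    proof -
      obtain x w where "v = x # w" using v by (cases v) auto
      moreover have "n x \<le> Max (range n)" by simp
      ultimately show ?thesis
        using n[of x w] v by (simp add: sect_word_elem_Cons word_elem_section_word)
    qed
    then show ?thesis by blast
  qed
qed

lemma contracting_to_nucleus: "contracting_to (carrier G) nucleus"
proof -
  have "nucleus \<subseteq> {id} \<union> (\<Union>i. (\<lambda>r::nat. a i [^]\<^bsub>G\<^esub> r) ` {..<gen_ord \<sigma> i})"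
    by (auto simp: nucleus_def)
  then have "finite nucleus"
    by (rule finite_subset) simp
  moreover have "nucleus \<subseteq> carrier G"
    using G.one_closed by (auto simp: nucleus_def simp del: G.one_closed)
  moreover have "\<exists>n. \<forall>v. n \<le> length v \<longrightarrow> sect g v \<in> nucleus" if "g \<in> carrier G" for g
  proof -
    obtain \<gamma> where "g = word_elem \<sigma> \<gamma>"
      using \<open>g \<in> carrier G\<close> by (auto simp: carrier_G_words)
    then have "g = word_elem \<sigma> (to_syllable_form (gen_ord \<sigma>) \<gamma>)"
      by (simp add: word_elem_to_syllable_form)
    then show ?thesis
      using sections_eventually_in_nucleus syllable_form_to_syllable_form gen_ord_pos by metis
  qed
  ultimately show ?thesis
    by (simp add: contracting_to_def)
qed

text \<open>Every element of the nucleus is its own section at arbitrarily deep vertices \<open>i \<dots> i\<close>; therefore it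
  lies in every set that absorbs all deep sections.\<close>

lemma is_nucleus_G: "is_nucleus (carrier G) nucleus"
  unfolding is_nucleus_def
proof (intro conjI allI impI subsetI)
  show "contracting_to (carrier G) nucleus" by (rule contracting_to_nucleus)
next
  fix M g
  assume M: "contracting_to (carrier G) M" and g: "g \<in> nucleus"
  have "g \<in> carrier G"
    using contracting_to_nucleus g by (auto simp: contracting_to_def)
  then obtain n where n: "\<And>v. n \<le> length v \<Longrightarrow> sect g v \<in> M"
    using M unfolding contracting_to_def by blast
  have "\<exists>i. \<forall>n. sect g (replicate n i) = g"
  proof (cases "g = id")
    case True
    then show ?thesis by (auto simp: sect_def)
  next
    case False
    then obtain i and r :: nat where gi: "g = a i [^]\<^bsub>G\<^esub> r"
      using g by (auto simp: nucleus_def)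
    have "sect g (replicate n i) = g" for n
      by (induction n) (auto simp: sect_def gi pow_Cons)
    then show ?thesis by blast
  qed
  then show "g \<in> M"
    using n by (metis le_refl length_replicate)
qed

section \<open>The abelianization\<close>

text \<open>Each syllable of the word enters the section of exactly one \<open>x\<close>, namely of the letter that the
  preceding prefix carries to the index of the syllable.\<close>

lemma sum_exponent_raw_section: "(\<Sum>x\<in>UNIV. exponent (raw_section \<sigma> \<gamma> x) i) = exponent \<gamma> i"
proof (induction \<gamma>)
  case (Cons p \<gamma>)
  obtain j r where p: "p = (j, r)" by (cases p)
  have "bij (\<sigma> j [^]\<^bsub>P\<^esub> r)"
    using bij_P by simp
  then have "(\<Sum>x\<in>UNIV. exponent (raw_section \<sigma> \<gamma> ((\<sigma> j [^]\<^bsub>P\<^esub> r) x)) i) = exponent \<gamma> i"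
    using sum.reindex_bij_betw[of "\<sigma> j [^]\<^bsub>P\<^esub> r" UNIV UNIV "\<lambda>x. exponent (raw_section \<sigma> \<gamma> x) i"] Cons
    by (simp add: bij_def bij_betw_def)
  moreover have "exponent (raw_section \<sigma> (p # \<gamma>) x) i
      = (if x = j then if j = i then r else 0 else 0) + exponent (raw_section \<sigma> \<gamma> ((\<sigma> j [^]\<^bsub>P\<^esub> r) x)) i" for x
    by (simp add: p)
  ultimately show ?case
    by (simp add: p sum.distrib)
qed simp

text \<open>The exponent map is well defined on the group. A word that represents the identity has sections
  that represent the identity, and these are shorter once the word is in syllable form. By induction
  their exponents are divisible by the orders, hence so is the sum, which is the exponent of the word
  itself.\<close>

lemma exponent_of_relation:
  assumes "word_elem \<sigma> \<gamma> = id"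
  shows "int (gen_ord \<sigma> i) dvd exponent \<gamma> i"
  using assms
proof (induction "length \<gamma>" arbitrary: \<gamma> rule: less_induct)
  case less
  let ?\<delta> = "to_syllable_form (gen_ord \<sigma>) \<gamma>"
  have len: "length ?\<delta> \<le> length \<gamma>" and syl: "syllable_form (gen_ord \<sigma>) ?\<delta>"
    and elem: "word_elem \<sigma> ?\<delta> = id"
    using length_to_syllable_form syllable_form_to_syllable_form gen_ord_pos less.prems
    by (auto simp: word_elem_to_syllable_form)
  consider "?\<delta> = []" | j r where "?\<delta> = [(j, r)]" | "2 \<le> length ?\<delta>"
    by (cases ?\<delta> rule: remdups_adj.cases) auto
  then have "int (gen_ord \<sigma> i) dvd exponent ?\<delta> i"
  proof cases
    case 1
    then show ?thesis by simp
  next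
    case (2 j r)
    then show ?thesis using elem int_pow_eq_id_iff[of j r] by auto
  next
    case 3
    have "int (gen_ord \<sigma> i) dvd exponent (raw_section \<sigma> ?\<delta> x) i" for x
      using less.hyps[of "raw_section \<sigma> ?\<delta> x"] raw_section_shorter[OF syl 3, of x] len elem
      by (simp add: word_elem_eq_id_iff[of ?\<delta>])
    then show ?thesis
      by (simp add: sum_exponent_raw_section[of ?\<delta>, symmetric] dvd_sum)
  qed
  then show ?case
    by (metis exponent_to_syllable_form dvd_eq_mod_eq_0)
qed

lemma eps_word_elem: "eps \<sigma> (word_elem \<sigma> \<gamma>) = word_exponents \<sigma> \<gamma>"
proof -
  have "word_exponents \<sigma> \<delta> = word_exponents \<sigma> \<gamma>" if "word_elem \<sigma> \<delta> = word_elem \<sigma> \<gamma>" for \<delta>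
  proof
    fix i
    let ?\<eta> = "\<delta> @ rev (map (\<lambda>(i, r). (i, - r)) \<gamma>)"
    have "word_elem \<sigma> ?\<eta> = word_elem \<sigma> \<gamma> \<otimes>\<^bsub>G\<^esub> inv\<^bsub>G\<^esub> word_elem \<sigma> \<gamma>"
      unfolding G.word_eval_append[OF a_in_G] G.word_eval_inverse[OF a_in_G] that ..
    also have "\<dots> = id"
      using G.r_inv[of "word_elem \<sigma> \<gamma>"] G.word_eval_closed[OF a_in_G] by (simp del: G_mult)
    finally have "int (gen_ord \<sigma> i) dvd exponent ?\<eta> i"
      by (rule exponent_of_relation)
    then show "word_exponents \<sigma> \<delta> i = word_exponents \<sigma> \<gamma> i"
      by (simp add: word_exponents_eq mod_eq_dvd_iff)
  qed
  then show ?thesis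
    unfolding eps_def by (intro the_equality) blast+
qed

abbreviation "E \<equiv> exponent_group \<sigma>"

lemma carrier_E: "e \<in> carrier E \<longleftrightarrow> (\<forall>i. 0 \<le> e i \<and> e i < int (gen_ord \<sigma> i))"
  using gen_ord_pos by (auto simp: exponent_group_def carrier_integer_mod_group PiE_iff)

lemma E_mult: "e \<otimes>\<^bsub>E\<^esub> f = (\<lambda>i. (e i + f i) mod int (gen_ord \<sigma> i))"
  by (simp add: exponent_group_def fun_eq_iff)

lemma E_one: "\<one>\<^bsub>E\<^esub> = (\<lambda>i. 0)"
  by (simp add: exponent_group_def fun_eq_iff)

sublocale E: comm_group E
proof (rule group.group_comm_groupI)
  show "group E"
    by (simp add: exponent_group_def)
qed (simp add: E_mult add.commute)

lemma word_exponents_in_E: "word_exponents \<sigma> \<gamma> \<in> carrier E"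
  using gen_ord_pos by (simp add: carrier_E word_exponents_eq)

lemma eps_hom: "eps \<sigma> \<in> hom G E"
proof (rule homI)
  fix g assume "g \<in> carrier G"
  then show "eps \<sigma> g \<in> carrier E"
    by (auto simp: carrier_G_words eps_word_elem word_exponents_in_E)
next
  fix g h assume "g \<in> carrier G" "h \<in> carrier G"
  then obtain \<gamma> \<delta> where g: "g = word_elem \<sigma> \<gamma>" and h: "h = word_elem \<sigma> \<delta>"
    by (auto simp: carrier_G_words)
  show "eps \<sigma> (g \<otimes>\<^bsub>G\<^esub> h) = eps \<sigma> g \<otimes>\<^bsub>E\<^esub> eps \<sigma> h"
    unfolding g h G.word_eval_append[OF a_in_G, symmetric] eps_word_elem
    by (simp add: E_mult word_exponents_eq fun_eq_iff mod_simps)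
qed

sublocale eps: group_hom G E "eps \<sigma>"
  by (simp add: group_hom_def group_hom_axioms_def eps_hom G.is_group E.is_group)

lemma eps_surj: "eps \<sigma> ` carrier G = carrier E"
proof
  show "carrier E \<subseteq> eps \<sigma> ` carrier G"
  proof
    fix e assume e: "e \<in> carrier E"
    obtain xs :: "'x list" where xs: "set xs = UNIV" "distinct xs"
      using finite_distinct_list[OF finite] by blast
    have "exponent (map (\<lambda>i. (i, e i)) ys) k = (if k \<in> set ys then e k else 0)" if "distinct ys" for ys k
      using that by (induction ys) auto
    then have "word_exponents \<sigma> (map (\<lambda>i. (i, e i)) xs) = e"
      using e xs by (auto simp: word_exponents_eq carrier_E fun_eq_iff)
    then show "e \<in> eps \<sigma> ` carrier G"
      by (metis eps_word_elem carrier_G_words rangeI image_eqI)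
  qed
qed auto

text \<open>One inclusion holds since the target is abelian. For the other, a word whose exponents are divisible
  by the orders of the letters is trivial in the abelianization, where only exponents matter.\<close>

lemma kernel_eps: "kernel G E (eps \<sigma>) = derived G (carrier G)"
proof
  show "derived G (carrier G) \<subseteq> kernel G E (eps \<sigma>)"
  proof
    fix g assume g: "g \<in> derived G (carrier G)"
    have "eps \<sigma> ` derived G (carrier G) = {\<one>\<^bsub>E\<^esub>}"
      using eps.derived_img[of "carrier G"] E.derived_eq_singleton[of "carrier E"]
      by (simp add: eps_surj)
    then show "g \<in> kernel G E (eps \<sigma>)"
      using g G.derived_in_carrier[of "carrier G"] by (auto simp: kernel_def)
  qed
  interpret D: normal "derived G (carrier G)" G
    by (rule G.derived_self_is_normal)
  interpret A: comm_group "abelianization G"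
    by (rule G.derived_quot_is_comm_group)
  let ?h = "\<lambda>g. derived G (carrier G) #>\<^bsub>G\<^esub> g"
  have h: "?h \<in> hom G (abelianization G)"
    by (rule D.r_coset_hom_Mod)
  interpret h: group_hom G "abelianization G" ?h
    by (simp add: group_hom_def group_hom_axioms_def h G.is_group A.is_group)
  have ha: "(?h \<circ> a) i \<in> carrier (abelianization G)" for i
    using h.hom_closed[OF a_in_G] by simp
  show "kernel G E (eps \<sigma>) \<subseteq> derived G (carrier G)"
  proof
    fix g assume "g \<in> kernel G E (eps \<sigma>)"
    then obtain \<gamma> where g: "g = word_elem \<sigma> \<gamma>" "g \<in> carrier G" and "eps \<sigma> g = \<one>\<^bsub>E\<^esub>"
      by (auto simp: kernel_def carrier_G_words)
    then have "word_exponents \<sigma> \<gamma> = (\<lambda>i. 0)"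
      by (simp add: eps_word_elem E_one)
    then have dvd: "int (gen_ord \<sigma> i) dvd exponent \<gamma> i" for i
      by (simp add: fun_eq_iff word_exponents_eq dvd_eq_mod_eq_0)
    have "?h g = word_eval (abelianization G) (?h \<circ> a) \<gamma>"
      unfolding g by (rule hom_word_eval[OF G.is_group A.is_group h a_in_G])
    also have "\<dots> = (\<Otimes>\<^bsub>abelianization G\<^esub>i\<in>UNIV. (?h \<circ> a) i [^]\<^bsub>abelianization G\<^esub> exponent \<gamma> i)"
      by (rule A.word_eval_eq_finprod[OF ha])
    also have "\<dots> = \<one>\<^bsub>abelianization G\<^esub>"
    proof (rule A.finprod_one_eqI)
      fix i
      have "(?h \<circ> a) i [^]\<^bsub>abelianization G\<^esub> exponent \<gamma> i = ?h (a i [^]\<^bsub>G\<^esub> exponent \<gamma> i)"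
        by (simp add: h.hom_int_pow)
      also have "a i [^]\<^bsub>G\<^esub> exponent \<gamma> i = \<one>\<^bsub>G\<^esub>"
        using dvd by (simp add: int_pow_eq_id_iff)
      finally show "(?h \<circ> a) i [^]\<^bsub>abelianization G\<^esub> exponent \<gamma> i = \<one>\<^bsub>abelianization G\<^esub>"
        by (simp only: h.hom_one)
    qed
    finally have "?h g = derived G (carrier G)"
      by simp
    then show "g \<in> derived G (carrier G)"
      using G.rcos_self[OF g(2) D.subgroup_axioms] by simp
  qed
qed

lemma eps_bar_iso: "eps_bar \<sigma> \<in> iso (abelianization G) E"
  using eps.FactGroup_iso_set[OF eps_surj] by (simp add: kernel_eps eps_bar_def[abs_def])

section \<open>Root permutations and the first level stabilizer\<close>

lemma root_perm_word_elem: "root_perm (word_elem \<sigma> \<gamma>) = word_perm \<sigma> \<gamma>"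
  by (simp add: root_perm_def word_elem_Cons)

lemma root_perm_hom: "root_perm \<in> hom G P"
proof (rule homI)
  fix g assume "g \<in> carrier G"
  then show "root_perm g \<in> carrier P"
    by (auto simp: carrier_G_words root_perm_word_elem)
next
  fix g h assume "g \<in> carrier G" "h \<in> carrier G"
  then obtain \<gamma> \<delta> where g: "g = word_elem \<sigma> \<gamma>" and h: "h = word_elem \<sigma> \<delta>"
    by (auto simp: carrier_G_words)
  show "root_perm (g \<otimes>\<^bsub>G\<^esub> h) = root_perm g \<otimes>\<^bsub>P\<^esub> root_perm h"
    unfolding g h G.word_eval_append[OF a_in_G, symmetric] root_perm_word_elem
    by (rule P.word_eval_append[OF \<sigma>_in_P])
qed

text \<open>The choice of a preimage under \<open>eps_bar\<close> in the definition of \<open>lam\<close> is harmless: \<open>eps_bar\<close> is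
  injective, so the chosen coset is the coset of \<open>g\<close>, and both \<open>eps\<close> and the class of the root
  permutation are constant on it.\<close>

lemma lam_eps:
  assumes g: "g \<in> carrier G"
  shows "lam \<sigma> (eps \<sigma> g) = derived P (carrier P) #>\<^bsub>P\<^esub> root_perm g"
proof -
  interpret D: normal "derived G (carrier G)" G
    by (rule G.derived_self_is_normal)
  interpret DP: normal "derived P (carrier P)" P
    by (rule P.derived_self_is_normal)
  interpret A: comm_group "abelianization P"
    by (rule P.derived_quot_is_comm_group)
  let ?C = "derived G (carrier G) #>\<^bsub>G\<^esub> g"
  let ?h = "\<lambda>g. derived P (carrier P) #>\<^bsub>P\<^esub> root_perm g"
  have "?h \<in> hom G (abelianization P)"
    using hom_compose[OF root_perm_hom DP.r_coset_hom_Mod] by (simp add: comp_def)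
  then interpret h: group_hom G "abelianization P" ?h
    by (simp add: group_hom_def group_hom_axioms_def G.is_group A.is_group)
  have h_derived: "?h k = \<one>\<^bsub>abelianization P\<^esub>" if "k \<in> derived G (carrier G)" for k
  proof -
    have "derived (abelianization P) (?h ` carrier G) = {\<one>\<^bsub>abelianization P\<^esub>}"
      by (rule A.derived_eq_singleton) (use h.hom_closed in blast)
    then have "?h ` derived G (carrier G) = {\<one>\<^bsub>abelianization P\<^esub>}"
      by (simp only: h.derived_img[OF subset_refl])
    then show ?thesis using that by blast
  qed
  have C: "?C \<in> carrier (abelianization G)"
    using g by (auto simp: FactGroup_def RCOSETS_def)
  have coset: "\<exists>k\<in>derived G (carrier G). c = k \<otimes>\<^bsub>G\<^esub> g" if "c \<in> ?C" for c
    using that by (auto simp: r_coset_def)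
  have sub: "derived G (carrier G) \<subseteq> carrier G"
    by (rule G.derived_in_carrier) simp
  have g_in: "g \<in> ?C"
    using G.rcos_self[OF g D.subgroup_axioms] .
  have "eps \<sigma> c = eps \<sigma> g" if c: "c \<in> ?C" for c
  proof -
    obtain k where k: "k \<in> derived G (carrier G)" "c = k \<otimes>\<^bsub>G\<^esub> g"
      using coset[OF c] by blast
    have "k \<in> kernel G E (eps \<sigma>)"
      using k(1) by (simp only: kernel_eps)
    then have "eps \<sigma> k = \<one>\<^bsub>E\<^esub>" "k \<in> carrier G"
      by (simp_all add: kernel_def)
    then have "eps \<sigma> c = \<one>\<^bsub>E\<^esub> \<otimes>\<^bsub>E\<^esub> eps \<sigma> g"
      unfolding k(2) using g by (simp only: eps.hom_mult)
    then show ?thesis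
      using eps.hom_closed[OF g] by (simp only: E.l_one)
  qed
  then have "eps \<sigma> ` ?C = {eps \<sigma> g}"
    using g_in by blast
  then have "eps_bar \<sigma> ?C = eps \<sigma> g"
    by (simp add: eps_bar_def)
  moreover have "inj_on (eps_bar \<sigma>) (carrier (abelianization G))"
    using eps_bar_iso by (auto simp: iso_def bij_betw_def)
  ultimately have inv: "inv_into (carrier (abelianization G)) (eps_bar \<sigma>) (eps \<sigma> g) = ?C"
    using C inv_into_f_f by metis
  have "?h c = ?h g" if c: "c \<in> ?C" for c
  proof -
    obtain k where k: "k \<in> derived G (carrier G)" "c = k \<otimes>\<^bsub>G\<^esub> g"
      using coset[OF c] by blast
    have "?h c = ?h k \<otimes>\<^bsub>abelianization P\<^esub> ?h g"
      unfolding k(2) using k(1) sub g by (intro h.hom_mult) auto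
    also have "\<dots> = ?h g"
      unfolding h_derived[OF k(1)] by (rule A.l_one[OF h.hom_closed[OF g]])
    finally show ?thesis .
  qed
  then have "?h ` ?C = {?h g}"
    using g_in by blast
  then show ?thesis
    by (simp add: lam_def inv rho_bar_def)
qed

lemma finprod_E:
  assumes "finite A" "\<And>j. j \<in> A \<Longrightarrow> f j \<in> carrier E"
  shows "(\<Otimes>\<^bsub>E\<^esub>j\<in>A. f j) = (\<lambda>i. (\<Sum>j\<in>A. f j i) mod int (gen_ord \<sigma> i))"
  using assms by (induction A) (auto simp: E_one E_mult E.finprod_insert mod_simps)

text \<open>By \<open>sum_exponent_raw_section\<close> the exponents of the first-level sections of \<open>g\<close> add up to those of
  \<open>g\<close>, and \<open>lam\<close> sends these to the class of the root permutation of \<open>g\<close>, which is trivial.\<close>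

theorem psi_level_one_stabilizer:
  "psi ` level_one_stabilizer (carrier G) \<subseteq>
     {(gs, id) | gs. (\<forall>j. gs j \<in> carrier G) \<and>
        (\<Otimes>\<^bsub>E\<^esub>j\<in>UNIV. eps \<sigma> (gs j)) \<in> kernel E (abelianization P) (lam \<sigma>)}"
proof
  fix p assume "p \<in> psi ` level_one_stabilizer (carrier G)"
  then obtain g where p: "p = psi g" and g: "g \<in> carrier G" and st: "\<And>x. g [x] = [x]"
    by (auto simp: level_one_stabilizer_def)
  obtain \<gamma> where \<gamma>: "g = word_elem \<sigma> \<gamma>"
    using g by (auto simp: carrier_G_words)
  have root: "root_perm g = id"
    by (auto simp: root_perm_def st)
  have psi: "p = ((\<lambda>x. word_elem \<sigma> (raw_section \<sigma> \<gamma> x)), id)"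
    unfolding p psi_def root by (simp add: \<gamma> sect_word_elem_singleton)
  have "(\<Otimes>\<^bsub>E\<^esub>j\<in>UNIV. eps \<sigma> (word_elem \<sigma> (raw_section \<sigma> \<gamma> j)))
      = (\<lambda>i. (\<Sum>j\<in>UNIV. exponent (raw_section \<sigma> \<gamma> j) i mod int (gen_ord \<sigma> i)) mod int (gen_ord \<sigma> i))"
    by (subst finprod_E) (simp_all add: eps_word_elem word_exponents_in_E word_exponents_eq)
  also have "\<dots> = eps \<sigma> g"
    by (simp add: mod_sum_eq sum_exponent_raw_section \<gamma> eps_word_elem word_exponents_eq fun_eq_iff)
  finally have prod: "(\<Otimes>\<^bsub>E\<^esub>j\<in>UNIV. eps \<sigma> (word_elem \<sigma> (raw_section \<sigma> \<gamma> j))) = eps \<sigma> g" .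
  have "derived P (carrier P) #>\<^bsub>P\<^esub> \<one>\<^bsub>P\<^esub> = derived P (carrier P)"
    by (rule P.coset_mult_one[OF P.derived_in_carrier]) simp
  then have "lam \<sigma> (eps \<sigma> g) = \<one>\<^bsub>abelianization P\<^esub>"
    using lam_eps[OF g] by (simp add: root)
  then have "eps \<sigma> g \<in> kernel E (abelianization P) (lam \<sigma>)"
    using eps.hom_closed[OF g] by (simp add: kernel_def)
  then show "p \<in> {(gs, id) | gs. (\<forall>j. gs j \<in> carrier G) \<and>
        (\<Otimes>\<^bsub>E\<^esub>j\<in>UNIV. eps \<sigma> (gs j)) \<in> kernel E (abelianization P) (lam \<sigma>)}"
    unfolding psi using prod by auto
qed

section \<open>Transitivity\<close>

text \<open>A syllable \<open>(i, r)\<close> met while the moving letter is at \<open>i\<close> does not move it and may be dropped. The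
  remaining syllables all act trivially below the moving letter. This yields elements that move one
  letter to another without disturbing anything below.\<close>

lemma trivial_section_connecting_word:
  "\<exists>\<delta>. word_perm \<sigma> \<delta> x = word_perm \<sigma> \<gamma> x \<and> raw_section \<sigma> \<delta> x = []"
proof (induction \<gamma> arbitrary: x)
  case Nil
  show ?case by (rule exI[of _ "[]"]) simp
next
  case (Cons p \<gamma>)
  obtain i r where p: "p = (i, r)" by (cases p)
  obtain \<delta> where \<delta>: "word_perm \<sigma> \<delta> ((\<sigma> i [^]\<^bsub>P\<^esub> r) x) = word_perm \<sigma> (p # \<gamma>) x"
      "raw_section \<sigma> \<delta> ((\<sigma> i [^]\<^bsub>P\<^esub> r) x) = []"
    using Cons[of "(\<sigma> i [^]\<^bsub>P\<^esub> r) x"] by (auto simp: p)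
  show ?case
  proof (cases "x = i")
    case True
    then show ?thesis using \<delta> by auto
  next
    case False
    then show ?thesis using \<delta> by (intro exI[of _ "p # \<delta>"]) (simp add: p)
  qed
qed

lemma transitive_connecting_element:
  assumes "transitive_on (carrier P) UNIV"
  shows "\<exists>g\<in>carrier G. \<forall>w. g (x # w) = y # w"
proof -
  obtain \<gamma> where "word_perm \<sigma> \<gamma> x = y"
    using assms by (auto simp: transitive_on_def carrier_P_words)
  then obtain \<delta> where "word_perm \<sigma> \<delta> x = y" "raw_section \<sigma> \<delta> x = []"
    using trivial_section_connecting_word by metis
  then have "word_elem \<sigma> \<delta> (x # w) = y # w" for w
    by (simp add: word_elem_Cons)
  then show ?thesis by (auto simp: carrier_G_words)
qed

lemma G_comp_closed: "g \<in> carrier G \<Longrightarrow> h \<in> carrier G \<Longrightarrow> h \<circ> g \<in> carrier G"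
  using G.m_closed[of g h] by simp

text \<open>Fractality in the strong form that also gives level transitivity. On the first level the generator
  \<open>a i\<close> is realized below \<open>x\<close> by moving \<open>x\<close> to \<open>i\<close> with trivial section, applying \<open>a i\<close>, and moving
  back with trivial section; deeper vertices follow by iteration.\<close>

lemma transitive_stabilizer_element:
  assumes tr: "transitive_on (carrier P) UNIV" and h: "h \<in> carrier G"
  shows "\<exists>g\<in>carrier G. \<forall>w. g (v @ w) = v @ h w"
proof (induction v)
  case Nil
  then show ?case using h by auto
next
  case (Cons x v)
  have lift: "\<exists>g\<in>carrier G. \<forall>w. g (x # w) = x # word_elem \<sigma> \<gamma> w" for \<gamma>
  proof (induction \<gamma>)
    case Nil
    show ?case using G.one_closed by (intro bexI[of _ id]) auto
  next
    case (Cons p \<gamma>)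
    obtain i r where p: "p = (i, r)" by (cases p)
    obtain g where g: "g \<in> carrier G" "\<And>w. g (x # w) = x # word_elem \<sigma> \<gamma> w"
      using Cons by blast
    obtain s where s: "s \<in> carrier G" "\<And>w. s (x # w) = i # w"
      using transitive_connecting_element[OF tr] by metis
    obtain t where t: "t \<in> carrier G" "\<And>w. t (i # w) = x # w"
      using transitive_connecting_element[OF tr] by metis
    have "(g \<circ> (t \<circ> ((a i [^]\<^bsub>G\<^esub> r) \<circ> s))) (x # w) = x # word_elem \<sigma> (p # \<gamma>) w" for w
      by (simp add: s t g int_pow_Cons p)
    moreover have "g \<circ> (t \<circ> ((a i [^]\<^bsub>G\<^esub> r) \<circ> s)) \<in> carrier G"
      using s t g by (intro G_comp_closed) auto
    ultimately show ?case by blast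
  qed
  obtain g where g: "g \<in> carrier G" "\<And>w. g (v @ w) = v @ h w"
    using Cons by blast
  then obtain \<gamma> where "g = word_elem \<sigma> \<gamma>" by (auto simp: carrier_G_words)
  then obtain k where "k \<in> carrier G" "\<And>w. k (x # w) = x # g w"
    using lift by blast
  then show ?case using g(2) by (intro bexI[of _ k]) simp_all
qed

lemma transitive_imp_fractal:
  assumes tr: "transitive_on (carrier P) UNIV"
  shows "fractal (carrier G)"
proof -
  have "h \<in> {sect g v |g. g \<in> carrier G \<and> g v = v}" if h: "h \<in> carrier G" for h v
  proof -
    obtain g where g: "g \<in> carrier G" "\<And>w. g (v @ w) = v @ h w"
      using transitive_stabilizer_element[OF tr h] by blast
    have "h [] = []"
      using length_G[OF h, of "[]"] by simp
    then have "g v = v"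
      using g(2)[of "[]"] by simp
    moreover have "sect g v = h"
      by (simp add: sect_def g)
    ultimately show ?thesis using g(1) by blast
  qed
  then show ?thesis
    using self_similar_G by (fastforce simp: fractal_def self_similar_def)
qed

lemma transitive_imp_level_transitive:
  assumes tr: "transitive_on (carrier P) UNIV"
  shows "level_transitive (carrier G)"
proof -
  have "\<exists>g\<in>carrier G. g v = w" if "length v = length w" for v w
    using that
  proof (induction v w rule: list_induct2)
    case Nil
    show ?case using G.one_closed by (intro bexI[of _ id]) auto
  next
    case (Cons x v y w)
    obtain h where h: "h \<in> carrier G" "h v = w" using Cons.IH by blast
    obtain s where s: "s \<in> carrier G" "\<And>w. s (x # w) = y # w"
      using transitive_connecting_element[OF tr] by metis
    obtain g where g: "g \<in> carrier G" "\<And>u. g ([y] @ u) = [y] @ h u"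
      using transitive_stabilizer_element[OF tr h(1)] by blast
    show ?case
      using G_comp_closed[OF s(1) g(1)] g(2) s(2) h(2) by (intro bexI[of _ "g \<circ> s"]) auto
  qed
  then show ?thesis
    by (auto simp: level_transitive_def transitive_on_def)
qed

lemma level_transitive_imp_transitive:
  assumes "level_transitive (carrier G)"
  shows "transitive_on (carrier P) UNIV"
  unfolding transitive_on_def
proof (intro ballI)
  fix x y :: 'x
  have "transitive_on (carrier G) {v. length v = 1}"
    using assms by (simp add: level_transitive_def)
  moreover have "[x] \<in> {v. length v = 1}" "[y] \<in> {v. length v = 1}"
    by simp_all
  ultimately have "\<exists>g\<in>carrier G. g [x] = [y]"
    unfolding transitive_on_def by blast
  then obtain g where g: "g \<in> carrier G" "g [x] = [y]"
    by blast
  then obtain \<gamma> where "g = word_elem \<sigma> \<gamma>" by (auto simp: carrier_G_words)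
  then have "word_perm \<sigma> \<gamma> x = y"
    using g by (simp add: word_elem_Cons)
  then show "\<exists>p\<in>carrier P. p x = y"
    by (auto simp: carrier_P_words)
qed

theorem fractal_level_transitive_iff:
  "fractal (carrier G) \<and> level_transitive (carrier G) \<longleftrightarrow> transitive_on (carrier P) UNIV"
  using transitive_imp_fractal transitive_imp_level_transitive level_transitive_imp_transitive by blast

end

section \<open>Means as limits of approximate means\<close>

lemma compact_unit_functions: "compact {\<mu> :: 'i \<Rightarrow> real. \<forall>A. \<mu> A \<in> {0..1}}"
proof -
  have "compactin (product_topology (\<lambda>_. euclidean) UNIV) (\<Pi>\<^sub>E A\<in>(UNIV :: 'i set). {0..1::real})"
    unfolding compactin_PiE by (simp add: compact_Icc)
  moreover have "(\<Pi>\<^sub>E A\<in>(UNIV :: 'i set). {0..1::real}) = {\<mu>. \<forall>A. \<mu> A \<in> {0..1}}"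
    by (auto simp: PiE_iff)
  ultimately show ?thesis
    unfolding euclidean_product_topology by simp
qed

text \<open>By compactness, a sequence of \<open>[0, 1]\<close>-valued functions on an arbitrary set has a subnet that
  converges pointwise. The subnet appears as a filter finer than \<open>sequentially\<close>.\<close>

lemma pointwise_subnet:
  fixes m :: "nat \<Rightarrow> 'i \<Rightarrow> real"
  assumes "\<And>n A. m n A \<in> {0..1}"
  shows "\<exists>F \<mu>. F \<le> sequentially \<and> F \<noteq> bot \<and> (\<forall>A. ((\<lambda>n. m n A) \<longlongrightarrow> \<mu> A) F)"
proof -
  let ?K = "{\<mu> :: 'i \<Rightarrow> real. \<forall>A. \<mu> A \<in> {0..1}}"
  have "filtermap m sequentially \<noteq> bot" "eventually (\<lambda>\<mu>. \<mu> \<in> ?K) (filtermap m sequentially)"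
    using assms by (simp_all add: filtermap_bot_iff eventually_filtermap)
  then obtain \<mu> where \<mu>: "inf (nhds \<mu>) (filtermap m sequentially) \<noteq> bot"
    using compact_unit_functions[where 'i='i] unfolding compact_filter by blast
  \<comment> \<open>The directions in which the index tends to infinity and the functions tend to the cluster point.\<close>
  define F where "F = inf sequentially (filtercomap m (nhds \<mu>))"
  have "filtermap m F \<noteq> bot"
  proof
    assume "filtermap m F = bot"
    then have "F = bot" by (simp add: filtermap_bot_iff)
    then have "eventually (\<lambda>_. False) F" by simp
    then obtain P Q where PQ: "eventually P sequentially" "eventually Q (nhds \<mu>)"
        "\<And>n. P n \<Longrightarrow> Q (m n) \<Longrightarrow> False"
      unfolding F_def eventually_inf eventually_filtercomap by auto
    have "eventually (\<lambda>\<nu>. \<not> Q \<nu>) (filtermap m sequentially)"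
      unfolding eventually_filtermap using PQ(1) by (rule eventually_mono) (use PQ(3) in blast)
    then have "eventually (\<lambda>_. False) (inf (nhds \<mu>) (filtermap m sequentially))"
      unfolding eventually_inf using PQ(2) by blast
    then show False using \<mu> by (simp add: trivial_limit_def)
  qed
  then have "F \<noteq> bot" by auto
  moreover have "((\<lambda>n. m n A) \<longlongrightarrow> \<mu> A) F" for A
  proof -
    have "filterlim m (nhds \<mu>) F"
      unfolding F_def by (meson filterlim_filtercomap filterlim_mono inf_le2 order_refl)
    moreover have "((\<lambda>\<nu>. \<nu> A) \<longlongrightarrow> \<mu> A) (nhds \<mu>)"
      using continuous_on_product_coordinates[of A, unfolded continuous_on_def, rule_format, of \<mu>]
        tendsto_at_iff_tendsto_nhds[of "\<lambda>\<nu>. \<nu> A" \<mu>] by blast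
    ultimately show ?thesis
      by (rule filterlim_compose[rotated])
  qed
  moreover have "F \<le> sequentially"
    by (simp add: F_def)
  ultimately show ?thesis
    by blast
qed

text \<open>A pointwise limit of asymptotically invariant finitely additive means is invariant. Invariance under
  generators is enough, because the elements that leave the limit invariant form a subgroup.\<close>

lemma (in group) amenableI_approximate_means:
  fixes m :: "nat \<Rightarrow> 'a set \<Rightarrow> real"
  assumes S: "S \<subseteq> carrier G" "generate G S = carrier G"
    and bounds: "\<And>n A. m n A \<in> {0..1}"
    and total: "\<And>n. m n (carrier G) = 1"
    and additive: "\<And>n A B. A \<inter> B = {} \<Longrightarrow> m n (A \<union> B) = m n A + m n B"
    and invariant: "\<And>s A. s \<in> S \<Longrightarrow> A \<subseteq> carrier G \<Longrightarrow> (\<lambda>n. m n (s <#\<^bsub>G\<^esub> A) - m n A) \<longlonglongrightarrow> 0"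
  shows "amenable G"
proof -
  obtain F \<mu> where F: "F \<le> sequentially" "F \<noteq> bot" and lim: "\<And>A. ((\<lambda>n. m n A) \<longlongrightarrow> \<mu> A) F"
    using pointwise_subnet[of m, OF bounds] by blast
  have "\<mu> (carrier G) = 1"
    using tendsto_unique[OF F(2) lim[of "carrier G"]] total by simp
  moreover have "0 \<le> \<mu> A" for A
    using tendsto_lowerbound[OF lim[of A] _ F(2), of 0] bounds by simp
  moreover have "\<mu> (A \<union> B) = \<mu> A + \<mu> B" if "A \<inter> B = {}" for A B
    using tendsto_unique[OF F(2) lim[of "A \<union> B"]] tendsto_add[OF lim[of A] lim[of B]] additive[OF that] by simp
  moreover have "\<forall>A. A \<subseteq> carrier G \<longrightarrow> \<mu> (g <#\<^bsub>G\<^esub> A) = \<mu> A" if "g \<in> carrier G" for g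
  proof -
    have closed: "g <#\<^bsub>G\<^esub> A \<subseteq> carrier G" if "g \<in> carrier G" "A \<subseteq> carrier G" for g A
      using that by (auto simp: l_coset_def)
    have S_inv: "\<mu> (s <#\<^bsub>G\<^esub> A) = \<mu> A" if "s \<in> S" "A \<subseteq> carrier G" for s A
    proof -
      have "((\<lambda>n. m n (s <#\<^bsub>G\<^esub> A) - m n A) \<longlongrightarrow> 0) F"
        using invariant[OF that] F(1) by (rule tendsto_mono[rotated])
      then have "\<mu> (s <#\<^bsub>G\<^esub> A) - \<mu> A = 0"
        using tendsto_unique[OF F(2)] tendsto_diff[OF lim lim] by metis
      then show ?thesis by simp
    qed
    have "g \<in> generate G S" using that S by simp
    then show ?thesis
    proof induction
      case one
      show ?case by (simp add: lcos_mult_one)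
    next
      case (incl s)
      then show ?case using S_inv by blast
    next
      case (inv s)
      show ?case
      proof (intro allI impI)
        fix A assume A: "A \<subseteq> carrier G"
        have s: "s \<in> carrier G" using inv S by blast
        have "\<mu> (s <#\<^bsub>G\<^esub> (inv s <#\<^bsub>G\<^esub> A)) = \<mu> (inv s <#\<^bsub>G\<^esub> A)"
          using S_inv[OF inv closed] s A by simp
        then show "\<mu> (inv s <#\<^bsub>G\<^esub> A) = \<mu> A"
          using s A by (simp add: lcos_m_assoc lcos_mult_one)
      qed
    next
      case (eng g h)
      have "g \<in> carrier G" "h \<in> carrier G"
        using eng S generate_in_carrier[OF S(1)] by blast+
      then show ?case
        using eng.IH closed by (simp add: lcos_m_assoc[symmetric])
    qed
  qed
  ultimately show ?thesis
    unfolding amenable_def using is_group by (intro conjI exI[of _ \<mu>]) auto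
qed

section \<open>The distance between two product distributions\<close>

text \<open>The total variation distance of the distributions \<open>f\<^sup>2\<close> and \<open>g\<^sup>2\<close> is bounded by their Hellinger
  distance, which is governed by the affinity \<open>\<Sum>c. f c * g c\<close>. The gain is that affinities of product
  distributions multiply.\<close>

lemma sum_abs_diff_squares_le:
  fixes f g :: "'c \<Rightarrow> real"
  assumes "(\<Sum>c\<in>C. (f c)\<^sup>2) = 1" "(\<Sum>c\<in>C. (g c)\<^sup>2) = 1"
  shows "(\<Sum>c\<in>C. \<bar>(f c)\<^sup>2 - (g c)\<^sup>2\<bar>) \<le> 2 * sqrt (2 - 2 * (\<Sum>c\<in>C. f c * g c))"
proof -
  have diff: "(\<Sum>c\<in>C. \<bar>f c - g c\<bar>\<^sup>2) = 2 - 2 * (\<Sum>c\<in>C. f c * g c)"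
    using assms by (simp add: power2_diff sum.distrib sum_subtractf sum_distrib_left mult.assoc)
  have "(\<Sum>c\<in>C. \<bar>f c + g c\<bar>\<^sup>2) \<le> (\<Sum>c\<in>C. 2 * (f c)\<^sup>2 + 2 * (g c)\<^sup>2)"
  proof (intro sum_mono)
    fix c
    show "\<bar>f c + g c\<bar>\<^sup>2 \<le> 2 * (f c)\<^sup>2 + 2 * (g c)\<^sup>2"
      using sum_squares_bound[of "f c" "g c"] by (simp add: power2_sum)
  qed
  also have "\<dots> = 4"
    using assms by (simp add: sum.distrib flip: sum_distrib_left)
  finally have add: "(\<Sum>c\<in>C. \<bar>f c + g c\<bar>\<^sup>2) \<le> 4" .
  have "(\<Sum>c\<in>C. \<bar>(f c)\<^sup>2 - (g c)\<^sup>2\<bar>) = (\<Sum>c\<in>C. \<bar>f c - g c\<bar> * \<bar>f c + g c\<bar>)"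
    by (intro sum.cong) (auto simp: abs_mult[symmetric] power2_eq_square algebra_simps)
  also have "\<dots> \<le> sqrt ((\<Sum>c\<in>C. \<bar>f c - g c\<bar>\<^sup>2) * (\<Sum>c\<in>C. \<bar>f c + g c\<bar>\<^sup>2))"
    by (rule real_le_rsqrt, rule Cauchy_Schwarz_ineq_sum)
  also have "\<dots> \<le> sqrt ((\<Sum>c\<in>C. \<bar>f c - g c\<bar>\<^sup>2) * 4)"
    using add by (intro real_sqrt_le_mono mult_left_mono sum_nonneg) auto
  finally show ?thesis
    unfolding diff real_sqrt_mult by (simp add: mult.commute)
qed

text \<open>For independent coordinates the squares of the distances of the coordinates add up, instead of the
  distances themselves. This is decisive below, where about \<open>n\<close> coordinates change by about \<open>1 / n\<close>
  each: the squares have sum of order \<open>1 / n\<close>, while the distances do not become small.\<close>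

lemma product_distribution_distance:
  fixes F F' :: "'u \<Rightarrow> 'v \<Rightarrow> real"
  assumes fin: "finite U" "finite V"
    and nonneg: "\<And>u v. F u v \<ge> 0" "\<And>u v. F' u v \<ge> 0"
    and unit: "\<And>u. u \<in> U \<Longrightarrow> (\<Sum>v\<in>V. (F u v)\<^sup>2) = 1" "\<And>u. u \<in> U \<Longrightarrow> (\<Sum>v\<in>V. (F' u v)\<^sup>2) = 1"
  shows "(\<Sum>c\<in>PiE U (\<lambda>_. V). \<bar>(\<Prod>u\<in>U. F u (c u))\<^sup>2 - (\<Prod>u\<in>U. F' u (c u))\<^sup>2\<bar>)
    \<le> 2 * sqrt (\<Sum>u\<in>U. \<Sum>v\<in>V. (F u v - F' u v)\<^sup>2)"
proof -
  let ?C = "PiE U (\<lambda>_. V)"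
  have norm: "(\<Sum>c\<in>?C. (\<Prod>u\<in>U. H u (c u))\<^sup>2) = 1" if "\<And>u. u \<in> U \<Longrightarrow> (\<Sum>v\<in>V. (H u v)\<^sup>2) = 1" for H :: "'u \<Rightarrow> 'v \<Rightarrow> real"
    using prod_sum_PiE[of U "\<lambda>_. V" "\<lambda>u v. (H u v)\<^sup>2"] fin that by (simp add: prod_power_distrib)
  define h where "h u = (\<Sum>v\<in>V. (F u v - F' u v)\<^sup>2) / 2" for u
  have h: "(\<Sum>v\<in>V. F u v * F' u v) = 1 - h u" if "u \<in> U" for u
  proof -
    have "(\<Sum>v\<in>V. (F u v - F' u v)\<^sup>2) = 2 - 2 * (\<Sum>v\<in>V. F u v * F' u v)"
      using unit[OF that]
      by (simp add: power2_diff sum.distrib sum_subtractf mult.assoc flip: sum_distrib_left)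
    then show ?thesis
      unfolding h_def by linarith
  qed
  have h01: "h u \<in> {0..1}" if "u \<in> U" for u
  proof -
    have "0 \<le> (\<Sum>v\<in>V. F u v * F' u v)"
      using nonneg by (intro sum_nonneg) auto
    then have "h u \<le> 1"
      using h[OF that] by linarith
    moreover have "0 \<le> h u"
      by (simp add: h_def sum_nonneg)
    ultimately show ?thesis by simp
  qed
  have "(\<Sum>c\<in>?C. (\<Prod>u\<in>U. F u (c u)) * (\<Prod>u\<in>U. F' u (c u))) = (\<Prod>u\<in>U. \<Sum>v\<in>V. F u v * F' u v)"
    using prod_sum_PiE[of U "\<lambda>_. V" "\<lambda>u v. F u v * F' u v"] fin by (simp add: prod.distrib)
  also have "\<dots> = (\<Prod>u\<in>U. 1 - h u)"
    by (intro prod.cong) (use h in auto)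
  also have "\<dots> \<ge> 1 - sum h U"
    using h01 by (intro Weierstrass_prod_ineq)
  finally have "2 - 2 * (\<Sum>c\<in>?C. (\<Prod>u\<in>U. F u (c u)) * (\<Prod>u\<in>U. F' u (c u))) \<le> 2 * sum h U"
    by simp
  also have "2 * sum h U = (\<Sum>u\<in>U. \<Sum>v\<in>V. (F u v - F' u v)\<^sup>2)"
    by (simp add: h_def sum_divide_distrib[symmetric])
  finally show ?thesis
    using sum_abs_diff_squares_le[OF norm norm, of F F'] unit by (fastforce intro: order_trans)
qed

text \<open>The square root of the distribution \<open>(1 - s\<^sup>2) \<delta>\<^sub>0 + s\<^sup>2 \<upsilon>\<close> on \<open>{0..<m}\<close>, with \<open>\<upsilon>\<close> uniform: a path from
  the point mass at \<open>0\<close> for \<open>s = 0\<close> to the uniform distribution for \<open>s = 1\<close>. The weight of \<open>\<upsilon>\<close> is \<open>s\<^sup>2\<close>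
  because then the square root depends on \<open>s\<close> in a Lipschitz way even at \<open>s = 0\<close>.\<close>

definition amplitude :: "nat \<Rightarrow> real \<Rightarrow> nat \<Rightarrow> real" where
  "amplitude m s r = (if r = 0 then sqrt (1 - s\<^sup>2 * (1 - 1 / real m)) else s / sqrt (real m))"

lemma amplitude_radicand:
  assumes "m > 0" "0 \<le> s" "s \<le> 1"
  shows "1 / real m \<le> 1 - s\<^sup>2 * (1 - 1 / real m)"
proof -
  have "s\<^sup>2 * (1 - 1 / real m) \<le> 1 * (1 - 1 / real m)"
    using assms by (intro mult_right_mono) (auto simp: power_le_one)
  then show ?thesis by simp
qed

lemma amplitude_radicand_nonneg:
  assumes "m > 0" "0 \<le> s" "s \<le> 1"
  shows "s\<^sup>2 * (1 - 1 / real m) \<le> 1"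
  using amplitude_radicand[OF assms] assms(1) by (smt (verit) divide_pos_pos of_nat_0_less_iff)

lemma amplitude_nonneg:
  assumes "m > 0" "0 \<le> s" "s \<le> 1"
  shows "0 \<le> amplitude m s r"
  using amplitude_radicand_nonneg[OF assms] assms by (auto simp: amplitude_def)

lemma sum_lessThan_split_0:
  fixes f :: "nat \<Rightarrow> real"
  assumes "m > 0" and "\<And>r. r > 0 \<Longrightarrow> f r = b"
  shows "(\<Sum>r<m. f r) = f 0 + (real m - 1) * b"
proof -
  have "{..<m} = insert 0 {1..<m}" using assms(1) by auto
  moreover have "(\<Sum>r\<in>{1..<m}. f r) = (\<Sum>r\<in>{1..<m}. b)"
    using assms(2) by (intro sum.cong) auto
  ultimately show ?thesis using assms(1) by (simp add: of_nat_diff)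
qed

lemma amplitude_unit:
  assumes "m > 0" "0 \<le> s" "s \<le> 1"
  shows "(\<Sum>r<m. (amplitude m s r)\<^sup>2) = 1"
proof -
  have "(\<Sum>r<m. (amplitude m s r)\<^sup>2) = (amplitude m s 0)\<^sup>2 + (real m - 1) * (s\<^sup>2 / real m)"
    using assms by (intro sum_lessThan_split_0) (auto simp: amplitude_def power_divide)
  also have "(amplitude m s 0)\<^sup>2 = 1 - s\<^sup>2 * (1 - 1 / real m)"
    using amplitude_radicand_nonneg[OF assms] by (simp add: amplitude_def)
  finally show ?thesis
    using assms(1) by (simp add: field_simps)
qed

lemma amplitude_1: "m > 0 \<Longrightarrow> amplitude m 1 r = 1 / sqrt (real m)"
  by (simp add: amplitude_def real_sqrt_divide)

lemma amplitude_0: "amplitude m 0 r = (if r = 0 then 1 else 0)"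
  by (simp add: amplitude_def)

lemma amplitude_Lipschitz:
  assumes m: "m > 0" and s: "0 \<le> s" "s \<le> 1" and t: "0 \<le> t" "t \<le> 1"
  shows "(\<Sum>r<m. (amplitude m s r - amplitude m t r)\<^sup>2) \<le> (real m + 1) * (s - t)\<^sup>2"
proof -
  have "(\<Sum>r<m. (amplitude m s r - amplitude m t r)\<^sup>2)
      = (amplitude m s 0 - amplitude m t 0)\<^sup>2 + (real m - 1) * ((s - t)\<^sup>2 / real m)"
    using m by (intro sum_lessThan_split_0) (auto simp: amplitude_def power_divide diff_divide_distrib[symmetric])
  also have "(real m - 1) * ((s - t)\<^sup>2 / real m) \<le> (s - t)\<^sup>2"
    using m by (simp add: field_simps)
  also have "(amplitude m s 0 - amplitude m t 0)\<^sup>2 \<le> real m * (s - t)\<^sup>2"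
  proof -
    define x where "x = amplitude m s 0"
    define y where "y = amplitude m t 0"
    have x: "x = sqrt (1 - s\<^sup>2 * (1 - 1 / real m))" and y: "y = sqrt (1 - t\<^sup>2 * (1 - 1 / real m))"
      by (simp_all add: x_def y_def amplitude_def)
    have sq: "x\<^sup>2 = 1 - s\<^sup>2 * (1 - 1 / real m)" "y\<^sup>2 = 1 - t\<^sup>2 * (1 - 1 / real m)"
      unfolding x y using amplitude_radicand_nonneg[OF m s] amplitude_radicand_nonneg[OF m t] by simp_all
    have "sqrt (1 / real m) \<le> x" "sqrt (1 / real m) \<le> y"
      unfolding x y using real_sqrt_le_mono amplitude_radicand[OF m s] amplitude_radicand[OF m t] by blast+
    then have lower: "1 / sqrt (real m) \<le> x" "1 / sqrt (real m) \<le> y"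
      by (simp_all add: real_sqrt_divide)
    have k: "0 \<le> 1 - 1 / real m" "1 - 1 / real m \<le> 1"
      using m by simp_all
    have "(1 - s\<^sup>2 * q) - (1 - t\<^sup>2 * q) = (t - s) * ((t + s) * q)" for q
      by (simp add: power2_eq_square algebra_simps)
    then have "x\<^sup>2 - y\<^sup>2 = (t - s) * ((t + s) * (1 - 1 / real m))"
      unfolding sq .
    then have "\<bar>x - y\<bar> * \<bar>x + y\<bar> = \<bar>(t - s) * ((t + s) * (1 - 1 / real m))\<bar>"
      by (simp add: square_diff_square_factored power2_eq_square mult.commute flip: abs_mult)
    also have "\<dots> = \<bar>t - s\<bar> * ((t + s) * (1 - 1 / real m))"
      using s t k by (simp add: abs_mult)
    also have "\<dots> \<le> \<bar>t - s\<bar> * (2 * 1)"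
      using s t k by (intro mult_left_mono mult_mono) auto
    finally have "\<bar>x - y\<bar> * \<bar>x + y\<bar> \<le> 2 * \<bar>s - t\<bar>"
      by (simp add: abs_minus_commute)
    moreover have "\<bar>x - y\<bar> * (2 / sqrt (real m)) \<le> \<bar>x - y\<bar> * \<bar>x + y\<bar>"
      using lower by (intro mult_left_mono) auto
    ultimately have "\<bar>x - y\<bar> * (2 / sqrt (real m)) \<le> 2 * \<bar>s - t\<bar>"
      by linarith
    then have "\<bar>x - y\<bar> \<le> sqrt (real m) * \<bar>s - t\<bar>"
      using m by (simp add: field_simps)
    then have "\<bar>x - y\<bar>\<^sup>2 \<le> (sqrt (real m) * \<bar>s - t\<bar>)\<^sup>2"
      by (intro power_mono) auto
    then show ?thesis
      by (simp add: x_def y_def power_mult_distrib)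
  qed
  finally show ?thesis
    by (simp add: algebra_simps)
qed

section \<open>Tails of infinite words\<close>

text \<open>A nonempty word \<open>u\<close> encodes the point \<open>u i i i \<dots>\<close> of the boundary of the tree, where \<open>i\<close> is the last
  letter of \<open>u\<close>. Then \<open>preperiod u\<close> is the number of letters before the constant tail of this point.\<close>

fun preperiod :: "'x list \<Rightarrow> nat" where
  "preperiod [] = 0"
| "preperiod (x # w) = (if w = replicate (length w) x then 0 else Suc (preperiod w))"

lemma preperiod_replicate [simp]: "preperiod (replicate n x) = 0"
  by (cases n) simp_all

lemma preperiod_less: "u \<noteq> [] \<Longrightarrow> preperiod u < length u"
proof (induction u)
  case (Cons x w)
  then show ?case by (cases "w = []") auto
qed simp

lemma preperiod_replicate_snoc: "y \<noteq> x \<Longrightarrow> preperiod (replicate n x @ [y]) = n"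
proof (induction n)
  case (Suc n)
  have "y \<in> set (replicate n x @ [y])" by simp
  then have "replicate n x @ [y] \<noteq> replicate (length (replicate n x @ [y])) x"
    using Suc.prems by (metis in_set_replicate)
  then show ?case using Suc by simp
qed simp

abbreviation words :: "nat \<Rightarrow> 'x list set" where
  "words n \<equiv> {u. length u = n}"

lemma finite_words: "finite (words n :: 'x::finite list set)"
  using finite_lists_length_eq[of "UNIV :: 'x set" n] by simp

context spinal_hanoi
begin

lemma length_a [simp]: "length (a j u) = length u"
  by (induction u) simp_all

lemma inj_a: "inj (a j)"
  using bij_G[OF a_in_G] by (rule bij_is_inj)

lemma a_replicate [simp]: "a j (replicate n j) = replicate n j"
  by (induction n) (simp_all add: \<sigma>_fixes)

lemma a_append: "a j (u @ v) = a j u @ (if u = replicate (length u) j then a j v else v)"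
  by (induction u) auto

lemma a_eq_replicate_iff: "a j u = replicate (length u) j \<longleftrightarrow> u = replicate (length u) j"
  using inj_eq[OF inj_a, of j u "replicate (length u) j"] by simp

lemma \<sigma>_eq_iff: "\<sigma> j x = j \<longleftrightarrow> x = j"
  using bij_\<sigma>[of j] \<sigma>_fixes[of j] by (metis bij_is_inj inj_eq)

text \<open>A generator changes at most a single letter of a word, the first one that differs from \<open>j\<close>. This
  affects the constant tail only if all later letters are equal, and then the tail starts either at the
  changed letter or right after it.\<close>

lemma preperiod_a_diff: "preperiod (a j u) \<le> Suc (preperiod u) \<and> preperiod u \<le> Suc (preperiod (a j u))"
proof (induction u)
  case (Cons x w)
  show ?case
  proof (cases "x = j")
    case True
    then show ?thesis using Cons a_eq_replicate_iff[of j w] by (simp add: \<sigma>_fixes)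
  next
    case False
    have "preperiod w = 0" if "w = replicate (length w) z" for z
      using that by (metis preperiod_replicate)
    then show ?thesis using False by auto
  qed
qed simp

lemma preperiod_a_change:
  assumes "preperiod (a j u) \<noteq> preperiod u"
  shows "\<exists>p<length u. \<exists>y i. u = replicate p j @ y # replicate (length u - Suc p) i"
  using assms
proof (induction u)
  case (Cons x w)
  show ?case
  proof (cases "x = j")
    case True
    then have "preperiod (a j w) \<noteq> preperiod w"
      using Cons.prems a_eq_replicate_iff[of j w] by (auto simp: \<sigma>_fixes split: if_splits)
    then obtain p y i where "p < length w" "w = replicate p j @ y # replicate (length w - Suc p) i"
      using Cons.IH by blast
    then show ?thesis
      using True by (intro exI[of _ "Suc p"] conjI exI[of _ y] exI[of _ i]) auto
  next
    case False
    then obtain i where "w = replicate (length w) i"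
      using Cons.prems by (auto split: if_splits)
    then show ?thesis
      by (intro exI[of _ 0] conjI exI[of _ x] exI[of _ i]) auto
  qed
qed simp

text \<open>Among the exponentially many words of length \<open>n + 1\<close>, only a linear number changes its preperiod,
  and by \<open>preperiod_a_diff\<close> only by one. In terms of the action on the orbit of \<open>i i i \<dots>\<close>, the sets of
  points of bounded preperiod have boundaries of bounded size. This makes the orbital graph recurrent.\<close>

lemma card_preperiod_change:
  "card {u \<in> words (Suc n). preperiod (a j u) \<noteq> preperiod u} \<le> Suc n * (CARD('x) * CARD('x))"
proof -
  let ?f = "\<lambda>(p, y, i). replicate p j @ y # replicate (n - p) i"
  have "{u \<in> words (Suc n). preperiod (a j u) \<noteq> preperiod u} \<subseteq> ?f ` ({..<Suc n} \<times> UNIV \<times> UNIV)"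
  proof
    fix u assume "u \<in> {u \<in> words (Suc n). preperiod (a j u) \<noteq> preperiod u}"
    then have len: "length u = Suc n" and "preperiod (a j u) \<noteq> preperiod u"
      by auto
    then obtain p y i where "p < length u" "u = replicate p j @ y # replicate (length u - Suc p) i"
      using preperiod_a_change by blast
    with len show "u \<in> ?f ` ({..<Suc n} \<times> UNIV \<times> UNIV)"
      by (intro image_eqI[of _ _ "(p, y, i)"]) simp_all
  qed
  then have "card {u \<in> words (Suc n). preperiod (a j u) \<noteq> preperiod u}
      \<le> card (?f ` ({..<Suc n} \<times> UNIV \<times> (UNIV :: 'x set)))"
    by (intro card_mono) auto
  also have "\<dots> \<le> card ({..<Suc n} \<times> (UNIV :: 'x set) \<times> (UNIV :: 'x set))"
    by (rule card_image_le) simp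
  finally show ?thesis by (simp add: card_cartesian_product)
qed

section \<open>A free action of the group\<close>

text \<open>Maps that are injective on all sufficiently long words. Precomposition with tree automorphisms acts
  freely on them, because an automorphism is determined by its values on long words; short words are
  left out so that the values there may be chosen without care.\<close>

definition eventually_injective :: "('x list \<Rightarrow> 'x list) set" where
  "eventually_injective = {\<gamma>. \<exists>n. inj_on \<gamma> {w. n < length w}}"

lemma eventually_injective_cancel:
  assumes \<gamma>: "\<gamma> \<in> eventually_injective" and g: "g \<in> carrier G" and h: "h \<in> carrier G"
    and eq: "\<gamma> \<circ> g = \<gamma> \<circ> h"
  shows "g = h"
proof
  fix v
  obtain n where n: "inj_on \<gamma> {w. n < length w}"
    using \<gamma> by (auto simp: eventually_injective_def)
  obtain w :: "'x list" where w: "length w = Suc n"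
    by (metis length_replicate)
  have "\<gamma> (g (v @ w)) = \<gamma> (h (v @ w))"
    using fun_cong[OF eq, of "v @ w"] by simp
  then have "g (v @ w) = h (v @ w)"
    by (rule inj_onD[OF n]) (simp_all add: length_G[OF g] length_G[OF h] w)
  moreover have "g \<in> carrier tree_Aut" "h \<in> carrier tree_Aut"
    using g h carrier_G_subset by auto
  ultimately have "g v @ sect g v w = h v @ sect h v w"
    by (simp add: sect_eq)
  then show "g v = h v"
    using length_G[OF g, of v] length_G[OF h, of v] by simp
qed

lemma eventually_injective_comp:
  assumes \<gamma>: "\<gamma> \<in> eventually_injective" and g: "g \<in> carrier G"
  shows "\<gamma> \<circ> g \<in> eventually_injective"
proof -
  obtain n where n: "inj_on \<gamma> {w. n < length w}"
    using \<gamma> by (auto simp: eventually_injective_def)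
  have "g ` {w. n < length w} \<subseteq> {w. n < length w}"
    using length_G[OF g] by auto
  moreover have "inj_on g {w. n < length w}"
    using bij_is_inj[OF bij_G[OF g]] by (rule inj_on_subset) simp
  ultimately have "inj_on (\<gamma> \<circ> g) {w. n < length w}"
    using n by (meson comp_inj_on inj_on_subset)
  then show ?thesis
    unfolding eventually_injective_def by blast
qed

text \<open>A free action admits an equivariant map to the group: fix a representative of each orbit and send
  every point to the unique element that carries the representative to it. Through this map, means on
  the maps of this kind become means on the group.\<close>

lemma equivariant_retraction:
  "\<exists>R. \<forall>\<gamma>\<in>eventually_injective. R \<gamma> \<in> carrier G \<and> (\<forall>g\<in>carrier G. R (\<gamma> \<circ> g) = R \<gamma> \<circ> g)"
proof -
  define orb where "orb \<gamma> = {\<gamma> \<circ> g | g. g \<in> carrier G}" for \<gamma> :: "'x list \<Rightarrow> 'x list"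
  define rep where "rep \<gamma> = (SOME \<delta>. \<delta> \<in> orb \<gamma>)" for \<gamma>
  define R where "R \<gamma> = (THE h. h \<in> carrier G \<and> \<gamma> = rep \<gamma> \<circ> h)" for \<gamma>
  have id: "id \<in> carrier G"
    using G.one_closed by simp
  have inv: "\<exists>k\<in>carrier G. g \<circ> k = id \<and> k \<circ> g = id" if "g \<in> carrier G" for g
    using G.r_inv[OF that] G.l_inv[OF that] G.inv_closed[OF that] unfolding G_mult G_one by blast
  have orb_comp: "orb (\<gamma> \<circ> g) = orb \<gamma>" if g: "g \<in> carrier G" for \<gamma> g
  proof -
    obtain k where k: "k \<in> carrier G" "g \<circ> k = id"
      using inv[OF g] by blast
    have "\<gamma> \<circ> h = (\<gamma> \<circ> g) \<circ> (k \<circ> h)" for h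
      using k(2) by (metis comp_assoc comp_id)
    moreover have "k \<circ> h \<in> carrier G" "g \<circ> h \<in> carrier G" if "h \<in> carrier G" for h
      using that G_comp_closed g k(1) by blast+
    moreover have "(\<gamma> \<circ> g) \<circ> h = \<gamma> \<circ> (g \<circ> h)" for h
      by (simp add: comp_assoc)
    ultimately show ?thesis
      unfolding orb_def by (intro subset_antisym subsetI) blast+
  qed
  have rep_orb: "rep \<gamma> \<in> orb \<gamma>" for \<gamma>
  proof -
    have "\<gamma> \<circ> id \<in> orb \<gamma>"
      unfolding orb_def using id by blast
    then show ?thesis
      unfolding rep_def by (rule someI[of "\<lambda>\<delta>. \<delta> \<in> orb \<gamma>"])
  qed
  have rep_ei: "rep \<gamma> \<in> eventually_injective" if \<gamma>: "\<gamma> \<in> eventually_injective" for \<gamma>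
  proof -
    obtain g where "g \<in> carrier G" "rep \<gamma> = \<gamma> \<circ> g"
      using rep_orb[of \<gamma>] unfolding orb_def by blast
    then show ?thesis
      using eventually_injective_comp[OF \<gamma>] by simp
  qed
  have R_unique: "R \<gamma> = h" if \<gamma>: "\<gamma> \<in> eventually_injective" and h: "h \<in> carrier G" "\<gamma> = rep \<gamma> \<circ> h" for \<gamma> h
    unfolding R_def
  proof (rule the_equality)
    show "h \<in> carrier G \<and> \<gamma> = rep \<gamma> \<circ> h"
      using h by blast
    fix k assume "k \<in> carrier G \<and> \<gamma> = rep \<gamma> \<circ> k"
    then show "k = h"
      using eventually_injective_cancel[OF rep_ei[OF \<gamma>], of k h] h by metis
  qed
  have R: "R \<gamma> \<in> carrier G" "\<gamma> = rep \<gamma> \<circ> R \<gamma>" if \<gamma>: "\<gamma> \<in> eventually_injective" for \<gamma>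
  proof -
    obtain g where g: "g \<in> carrier G" "rep \<gamma> = \<gamma> \<circ> g"
      using rep_orb[of \<gamma>] unfolding orb_def by blast
    obtain k where k: "k \<in> carrier G" "g \<circ> k = id"
      using inv[OF g(1)] by blast
    have "\<gamma> = rep \<gamma> \<circ> k"
      unfolding g(2) comp_assoc k(2) by simp
    then show "R \<gamma> \<in> carrier G" "\<gamma> = rep \<gamma> \<circ> R \<gamma>"
      using R_unique[OF \<gamma> k(1)] k(1) by simp_all
  qed
  have "R (\<gamma> \<circ> g) = R \<gamma> \<circ> g" if \<gamma>: "\<gamma> \<in> eventually_injective" and g: "g \<in> carrier G" for \<gamma> g
  proof (rule R_unique)
    show "\<gamma> \<circ> g \<in> eventually_injective"
      using \<gamma> g by (rule eventually_injective_comp)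
    show "R \<gamma> \<circ> g \<in> carrier G"
      using G_comp_closed g R(1)[OF \<gamma>] by blast
    have "rep (\<gamma> \<circ> g) = rep \<gamma>"
      by (simp add: rep_def orb_comp[OF g])
    then show "\<gamma> \<circ> g = rep (\<gamma> \<circ> g) \<circ> (R \<gamma> \<circ> g)"
      using R(2)[OF \<gamma>] by (metis comp_assoc)
  qed
  with R(1) show ?thesis by blast
qed

section \<open>Random configurations\<close>

text \<open>A pair of a permutation \<open>\<pi>\<close> of the words of length \<open>n + 1\<close> and a configuration \<open>c\<close> of exponents on these
  words is realized by the map \<open>u v \<mapsto> \<pi>(u) (a i)\<^bsup>c(u)\<^esup>(v)\<close>, where \<open>i\<close> is the last letter of \<open>u\<close>. The exponent
  \<open>c u\<close> is the germ of the map at the point \<open>u i i i \<dots>\<close>. Precomposition with \<open>a j\<close> permutes these germs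
  and adds one to the germ at \<open>j j j \<dots>\<close>; this is the effect of \<open>move\<close> on the pair. The permutation is
  uniformly distributed. The exponents are independent, uniform for points of preperiod \<open>0\<close> and zero for
  points of preperiod \<open>n\<close>; in between, the parameter of \<open>amplitude\<close> decreases linearly.\<close>

definition period :: nat where
  "period = (SOME m. m > 0 \<and> (\<forall>i. a i [^]\<^bsub>G\<^esub> m = id))"

lemma period_pos: "period > 0" and pow_period: "a i [^]\<^bsub>G\<^esub> period = id"
proof -
  have "\<exists>m::nat. m > 0 \<and> (\<forall>i. a i [^]\<^bsub>G\<^esub> m = id)"
    using common_order by blast
  from someI_ex[OF this] show "period > 0" "a i [^]\<^bsub>G\<^esub> period = id"
    by (simp_all add: period_def)
qed

lemma pow_mod_period: "a i [^]\<^bsub>G\<^esub> (r mod period) = a i [^]\<^bsub>G\<^esub> r"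
proof -
  have "a i [^]\<^bsub>G\<^esub> r = a i [^]\<^bsub>G\<^esub> (period * (r div period) + r mod period)"
    by simp
  also have "\<dots> = a i [^]\<^bsub>G\<^esub> (r mod period)"
    using G.nat_pow_mult[OF a_in_G, of i "period * (r div period)" "r mod period"]
      G.nat_pow_pow[OF a_in_G, of i period "r div period"] G.nat_pow_one
    by (simp add: pow_period)
  finally show ?thesis ..
qed

definition profile :: "nat \<Rightarrow> 'x list \<Rightarrow> nat \<Rightarrow> real" where
  "profile n u = amplitude period (1 - real (preperiod u) / real n)"

definition configurations :: "nat \<Rightarrow> ('x list \<Rightarrow> nat) set" where
  "configurations n = PiE (words (Suc n)) (\<lambda>_. {..<period})"

definition level_perms :: "nat \<Rightarrow> ('x list \<Rightarrow> 'x list) set" where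
  "level_perms n = {\<pi>. \<pi> permutes words (Suc n)}"

definition move_config :: "nat \<Rightarrow> 'x \<Rightarrow> ('x list \<Rightarrow> nat) \<Rightarrow> 'x list \<Rightarrow> nat" where
  "move_config n j c = (\<lambda>u\<in>words (Suc n).
     (c (a j u) + (if u = replicate (Suc n) j then 1 else 0)) mod period)"

definition level_action :: "nat \<Rightarrow> 'x \<Rightarrow> 'x list \<Rightarrow> 'x list" where
  "level_action n j u = (if length u = Suc n then a j u else u)"

definition move :: "nat \<Rightarrow> 'x \<Rightarrow> ('x list \<Rightarrow> 'x list) \<times> ('x list \<Rightarrow> nat) \<Rightarrow> ('x list \<Rightarrow> 'x list) \<times> ('x list \<Rightarrow> nat)" where
  "move n j = map_prod (\<lambda>\<pi>. \<pi> \<circ> level_action n j) (move_config n j)"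

definition weight :: "nat \<Rightarrow> ('x list \<Rightarrow> 'x list) \<times> ('x list \<Rightarrow> nat) \<Rightarrow> real" where
  "weight n = (\<lambda>(\<pi>, c). (\<Prod>u\<in>words (Suc n). profile n u (c u))\<^sup>2 / real (card (level_perms n)))"

definition realize :: "nat \<Rightarrow> ('x list \<Rightarrow> 'x list) \<times> ('x list \<Rightarrow> nat) \<Rightarrow> 'x list \<Rightarrow> 'x list" where
  "realize n = (\<lambda>(\<pi>, c) w. if length w \<le> n then [] else
     (let u = take (Suc n) w in \<pi> u @ (a (last u) [^]\<^bsub>G\<^esub> c u) (drop (Suc n) w)))"

lemma realize_append:
  "length u = Suc n \<Longrightarrow> realize n (\<pi>, c) (u @ v) = \<pi> u @ (a (last u) [^]\<^bsub>G\<^esub> c u) v"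
  by (simp add: realize_def)

lemma long_word_split:
  assumes "n < length w"
  obtains u v where "w = u @ v" "length u = Suc n"
  using that[of "take (Suc n) w" "drop (Suc n) w"] assms by simp

lemma realize_eventually_injective:
  assumes "\<pi> \<in> level_perms n"
  shows "realize n (\<pi>, c) \<in> eventually_injective"
proof -
  have \<pi>: "\<pi> permutes words (Suc n)"
    using assms by (simp add: level_perms_def)
  have "inj_on (realize n (\<pi>, c)) {w. n < length w}"
  proof (rule inj_onI; clarsimp)
    fix w w' assume len: "n < length w" "n < length w'" and eq: "realize n (\<pi>, c) w = realize n (\<pi>, c) w'"
    obtain u v where w: "w = u @ v" "length u = Suc n" using long_word_split[OF len(1)] .
    obtain u' v' where w': "w' = u' @ v'" "length u' = Suc n" using long_word_split[OF len(2)] .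
    have "length (\<pi> u) = length (\<pi> u')"
      using permutes_in_image[OF \<pi>, of u] permutes_in_image[OF \<pi>, of u'] w w' by simp
    then have "\<pi> u = \<pi> u'" and *: "(a (last u) [^]\<^bsub>G\<^esub> c u) v = (a (last u') [^]\<^bsub>G\<^esub> c u') v'"
      using eq by (simp_all add: w w' realize_append)
    then have "u = u'"
      using permutes_inj[OF \<pi>] by (simp add: inj_eq)
    moreover have "bij (a (last u) [^]\<^bsub>G\<^esub> c u)"
      using bij_G by simp
    ultimately show "w = w'"
      using * w w' by (metis bij_is_inj inj_eq)
  qed
  then show ?thesis
    unfolding eventually_injective_def by blast
qed

text \<open>The description by germs is exact except at the words \<open>j \<dots> j y\<close> with \<open>y \<noteq> j\<close>: there \<open>a j\<close> changes the last
  letter, hence the generator whose power is applied below. These words have preperiod \<open>n\<close>, so their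
  exponent is zero with probability one, and then it does not matter which generator is raised to it.\<close>

lemma realize_move:
  assumes "\<And>y. y \<noteq> j \<Longrightarrow> c (replicate n j @ [y]) = 0"
  shows "realize n (move n j (\<pi>, c)) = realize n (\<pi>, c) \<circ> a j"
proof
  fix w
  show "realize n (move n j (\<pi>, c)) w = (realize n (\<pi>, c) \<circ> a j) w"
  proof (cases "n < length w")
    case False
    then show ?thesis by (simp add: realize_def move_def)
  next
    case True
    then obtain u v where w: "w = u @ v" and u: "length u = Suc n"
      by (rule long_word_split)
    have lhs: "realize n (move n j (\<pi>, c)) w
        = \<pi> (a j u) @ (a (last u) [^]\<^bsub>G\<^esub> (c (a j u) + (if u = replicate (Suc n) j then 1 else 0))) v"
      using u by (simp add: w move_def realize_append level_action_def move_config_def pow_mod_period)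
    have rhs: "(realize n (\<pi>, c) \<circ> a j) w
        = \<pi> (a j u) @ (a (last (a j u)) [^]\<^bsub>G\<^esub> c (a j u)) (if u = replicate (length u) j then a j v else v)"
      using u by (simp add: w a_append realize_append)
    show ?thesis
    proof (cases "u = replicate (Suc n) j")
      case True
      have "a j [^]\<^bsub>G\<^esub> Suc (c u) = (a j [^]\<^bsub>G\<^esub> c u) \<circ> a j"
        using G.nat_pow_Suc2[OF a_in_G] by simp
      moreover have "a j u = u" "last u = j"
        using a_replicate[of j "Suc n"] True by (auto simp del: replicate_Suc simp: last_replicate)
      ultimately show ?thesis
        unfolding lhs rhs using True u by (simp del: replicate_Suc)
    next
      case False
      have "last (a j u) = last u \<or> c (a j u) = 0"
      proof -
        obtain u' y where u': "u = u' @ [y]" "length u' = n"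
          using u by (cases u rule: rev_cases) auto
        show ?thesis
        proof (cases "u' = replicate n j")
          case True
          then have "y \<noteq> j"
            using False u' by (auto simp: replicate_append_same)
          then have "\<sigma> j y \<noteq> j"
            by (simp add: \<sigma>_eq_iff)
          moreover have "a j u = replicate n j @ [\<sigma> j y]"
            using True \<open>y \<noteq> j\<close> by (simp add: u' a_append)
          ultimately show ?thesis
            using assms by simp
        next
          case False
          then show ?thesis using u' by (simp add: a_append)
        qed
      qed
      then show ?thesis
        unfolding lhs rhs using False u by auto
    qed
  qed
qed

lemma a_bij_words: "bij_betw (a j) (words n) (words n)"
proof -
  have "inj_on (a j) (words n)"
    using inj_a by (rule inj_on_subset) simp
  moreover have "a j ` words n \<subseteq> words n"
    by auto
  ultimately show ?thesis
    using endo_inj_surj[OF finite_words] unfolding bij_betw_def by blast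
qed

lemma level_action_permutes: "level_action n j permutes words (Suc n)"
proof (rule bij_imp_permutes)
  show "bij_betw (level_action n j) (words (Suc n)) (words (Suc n))"
    using a_bij_words[of j "Suc n"] by (rule bij_betw_cong[THEN iffD1, rotated]) (simp add: level_action_def)
qed (simp add: level_action_def)

lemma finite_level_perms: "finite (level_perms n)"
  unfolding level_perms_def by (rule finite_permutations[OF finite_words])

lemma finite_configurations: "finite (configurations n)"
  unfolding configurations_def by (intro finite_PiE finite_words) auto

lemma level_perms_nonempty: "card (level_perms n) > 0"
proof -
  have "id \<in> level_perms n"
    by (simp add: level_perms_def permutes_id)
  then show ?thesis
    using finite_level_perms by (auto simp: card_gt_0_iff)
qed

lemma move_bij:
  "bij_betw (move n j) (level_perms n \<times> configurations n) (level_perms n \<times> configurations n)"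
proof -
  have "inj_on (\<lambda>\<pi>. \<pi> \<circ> level_action n j) (level_perms n)"
    using permutes_surj[OF level_action_permutes[of n j]] by (auto intro!: inj_onI simp: surj_fun_eq o_def fun_eq_iff) (metis surjD)
  moreover have "(\<lambda>\<pi>. \<pi> \<circ> level_action n j) ` level_perms n \<subseteq> level_perms n"
    using permutes_compose[OF level_action_permutes] by (auto simp: level_perms_def)
  ultimately have 1: "bij_betw (\<lambda>\<pi>. \<pi> \<circ> level_action n j) (level_perms n) (level_perms n)"
    using endo_inj_surj[OF finite_level_perms] unfolding bij_betw_def by blast
  have "inj_on (move_config n j) (configurations n)"
  proof (rule inj_onI)
    fix c c' assume c: "c \<in> configurations n" "c' \<in> configurations n" and eq: "move_config n j c = move_config n j c'"
    show "c = c'"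
    proof (rule PiE_ext)
      show "c \<in> PiE (words (Suc n)) (\<lambda>_. {..<period})" "c' \<in> PiE (words (Suc n)) (\<lambda>_. {..<period})"
        using c by (simp_all add: configurations_def)
      fix v :: "'x list" assume v: "v \<in> words (Suc n)"
      then obtain u where u: "u \<in> words (Suc n)" "v = a j u"
        using a_bij_words[of j "Suc n"] by (auto simp: bij_betw_def)
      let ?k = "if u = replicate (Suc n) j then 1 else 0 :: nat"
      have "(c v + ?k) mod period = (c' v + ?k) mod period"
        using fun_cong[OF eq, of u] u by (simp add: move_config_def del: replicate_Suc)
      then have "[c v = c' v] (mod period)"
        unfolding cong_def[symmetric] by (simp only: cong_add_rcancel_nat)
      moreover have "c v < period" "c' v < period"
        using c v by (auto simp: configurations_def)
      ultimately show "c v = c' v"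
        by (simp add: cong_def)
    qed
  qed
  moreover have "move_config n j ` configurations n \<subseteq> configurations n"
    using period_pos by (auto simp: move_config_def configurations_def)
  ultimately have 2: "bij_betw (move_config n j) (configurations n) (configurations n)"
    using endo_inj_surj[OF finite_configurations] unfolding bij_betw_def by blast
  show ?thesis
    unfolding move_def using 1 2 by (rule bij_betw_map_prod)
qed

lemma profile_parameter:
  assumes "length u = Suc n" "n > 0"
  shows "0 \<le> 1 - real (preperiod u) / real n" "1 - real (preperiod u) / real n \<le> 1"
proof -
  have "preperiod u \<le> n"
    using preperiod_less[of u] assms(1) by (cases u) auto
  then show "0 \<le> 1 - real (preperiod u) / real n" "1 - real (preperiod u) / real n \<le> 1"
    using assms(2) by (auto simp: divide_le_eq_1)
qed

lemma profile_nonneg: "length u = Suc n \<Longrightarrow> n > 0 \<Longrightarrow> 0 \<le> profile n u r"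
  unfolding profile_def by (intro amplitude_nonneg period_pos profile_parameter)

lemma profile_unit: "length u = Suc n \<Longrightarrow> n > 0 \<Longrightarrow> (\<Sum>r<period. (profile n u r)\<^sup>2) = 1"
  unfolding profile_def by (intro amplitude_unit period_pos profile_parameter)

lemma sum_weight:
  assumes "n > 0"
  shows "(\<Sum>q\<in>level_perms n \<times> configurations n. weight n q) = 1"
proof -
  have "(\<Sum>c\<in>configurations n. (\<Prod>u\<in>words (Suc n). profile n u (c u))\<^sup>2)
      = (\<Prod>u\<in>words (Suc n). \<Sum>r<period. (profile n u r)\<^sup>2)"
    unfolding configurations_def using finite_words
    by (subst prod_sum_PiE) (simp_all add: prod_power_distrib)
  also have "\<dots> = 1"
    using profile_unit assms by (intro prod.neutral) simp
  finally show ?thesis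
    using level_perms_nonempty[of n]
    by (simp add: weight_def sum.cartesian_product[symmetric] sum_divide_distrib[symmetric])
qed

text \<open>At a point of preperiod \<open>n\<close> the exponent is distributed as the point mass at zero. This rules out the
  exceptional configurations of \<open>realize_move\<close>.\<close>

lemma weight_zero:
  assumes "n > 0" "y \<noteq> j" "c (replicate n j @ [y]) \<noteq> 0"
  shows "weight n (\<pi>, c) = 0"
proof -
  have "profile n (replicate n j @ [y]) (c (replicate n j @ [y])) = 0"
    using assms by (simp add: profile_def preperiod_replicate_snoc amplitude_0)
  then have "(\<Prod>u\<in>words (Suc n). profile n u (c u)) = 0"
    by (intro prod_zero[OF finite_words] bexI[of _ "replicate n j @ [y]"]) simp_all
  then show ?thesis by (simp add: weight_def)
qed

text \<open>The shift of the exponent at \<open>j \<dots> j\<close> is invisible, because the exponent there is uniformly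
  distributed. What remains is a permutation of the coordinates.\<close>

lemma prod_profile_move:
  assumes c: "c \<in> configurations n"
  shows "(\<Prod>u\<in>words (Suc n). profile n u (move_config n j c u))
    = (\<Prod>u\<in>words (Suc n). profile n (inv_into (words (Suc n)) (a j) u) (c u))"
proof -
  let ?b = "inv_into (words (Suc n)) (a j)"
  have "(\<Prod>u\<in>words (Suc n). profile n u (move_config n j c u)) = (\<Prod>u\<in>words (Suc n). profile n (?b (a j u)) (c (a j u)))"
  proof (rule prod.cong[OF refl])
    fix u :: "'x list" assume u: "u \<in> words (Suc n)"
    have b: "?b (a j u) = u"
      using a_bij_words[of j "Suc n"] u by (intro inv_into_f_f) (auto simp: bij_betw_def)
    have "a j u \<in> words (Suc n)"
      using u by simp
    then have lt: "c (a j u) < period"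
      using c by (auto simp: configurations_def)
    have "profile n u (move_config n j c u) = profile n u (c (a j u))"
    proof (cases "u = replicate (Suc n) j")
      case True
      have "preperiod u = 0" unfolding True by (rule preperiod_replicate)
      then show ?thesis by (simp add: profile_def amplitude_1 period_pos)
    next
      case False
      then show ?thesis using u lt by (simp add: move_config_def del: replicate_Suc)
    qed
    then show "profile n u (move_config n j c u) = profile n (?b (a j u)) (c (a j u))"
      by (simp add: b)
  qed
  also have "\<dots> = (\<Prod>u\<in>words (Suc n). profile n (?b u) (c u))"
    by (rule prod.reindex_bij_betw[OF a_bij_words])
  finally show ?thesis .
qed

text \<open>At most \<open>(n + 1) d\<^sup>2\<close> coordinates contribute, each at most a multiple of \<open>(1 / n)\<^sup>2\<close>. The factor \<open>2\<close>
  bounds \<open>(n + 1) / n\<close>.\<close>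

lemma profile_energy:
  assumes "n > 0"
  shows "(\<Sum>u\<in>words (Suc n). \<Sum>r<period. (profile n (a j u) r - profile n u r)\<^sup>2)
    \<le> 2 * (real period + 1) * (real CARD('x))\<^sup>2 / real n"
proof -
  let ?B = "{u \<in> words (Suc n). preperiod (a j u) \<noteq> preperiod u}"
  have B: "finite ?B"
    using finite_words by (rule finite_subset[rotated]) auto
  have "(\<Sum>u\<in>words (Suc n). \<Sum>r<period. (profile n (a j u) r - profile n u r)\<^sup>2)
      = (\<Sum>u\<in>?B. \<Sum>r<period. (profile n (a j u) r - profile n u r)\<^sup>2)"
    by (rule sum.mono_neutral_right[OF finite_words]) (auto simp: profile_def)
  also have "\<dots> \<le> (\<Sum>u\<in>?B. (real period + 1) * (1 / real n)\<^sup>2)"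
  proof (rule sum_mono)
    fix u assume u: "u \<in> ?B"
    have "(\<Sum>r<period. (profile n (a j u) r - profile n u r)\<^sup>2)
        \<le> (real period + 1) * ((1 - real (preperiod (a j u)) / real n) - (1 - real (preperiod u) / real n))\<^sup>2"
      unfolding profile_def using u assms
      by (intro amplitude_Lipschitz period_pos profile_parameter) auto
    also have "((1 - real (preperiod (a j u)) / real n) - (1 - real (preperiod u) / real n))\<^sup>2
        = (real (preperiod u) - real (preperiod (a j u)))\<^sup>2 / (real n)\<^sup>2"
      by (simp add: diff_divide_distrib[symmetric] power_divide)
    also have "(real (preperiod u) - real (preperiod (a j u)))\<^sup>2 \<le> 1"
    proof -
      have "\<bar>real (preperiod u) - real (preperiod (a j u))\<bar> \<le> 1"
        using preperiod_a_diff[of j u] by linarith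
      then show ?thesis by (simp add: abs_square_le_1)
    qed
    finally show "(\<Sum>r<period. (profile n (a j u) r - profile n u r)\<^sup>2) \<le> (real period + 1) * (1 / real n)\<^sup>2"
      by (simp add: divide_right_mono mult_left_mono power_divide)
  qed
  also have "\<dots> = real (card ?B) * ((real period + 1) * (1 / real n)\<^sup>2)"
    by simp
  also have "\<dots> \<le> real (Suc n * (CARD('x) * CARD('x))) * ((real period + 1) * (1 / real n)\<^sup>2)"
    by (intro mult_right_mono of_nat_mono card_preperiod_change) simp
  also have "\<dots> = (real (Suc n) / real n) * ((real period + 1) * (real CARD('x))\<^sup>2 / real n)"
    by (simp add: power2_eq_square) (simp add: algebra_simps)
  also have "\<dots> \<le> 2 * ((real period + 1) * (real CARD('x))\<^sup>2 / real n)"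
    using assms by (intro mult_right_mono) (auto simp: field_simps)
  also have "\<dots> = 2 * (real period + 1) * (real CARD('x))\<^sup>2 / real n"
    by (simp only: times_divide_eq_right mult.assoc)
  finally show ?thesis .
qed

lemma weight_move_distance:
  assumes n: "n > 0"
  shows "(\<Sum>q\<in>level_perms n \<times> configurations n. \<bar>weight n (move n j q) - weight n q\<bar>)
    \<le> 2 * sqrt (2 * (real period + 1) * (real CARD('x))\<^sup>2 / real n)"
proof -
  let ?W = "words (Suc n) :: 'x list set"
  let ?b = "inv_into ?W (a j)"
  have bW: "length (?b u) = Suc n" if "u \<in> ?W" for u
    using inv_into_into[of u "a j" ?W] a_bij_words[of j "Suc n"] that by (auto simp: bij_betw_def)
  \<comment> \<open>The functions are cut off outside the words so that they are nonnegative everywhere.\<close>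
  define F where "F u r = (if u \<in> ?W then profile n (?b u) r else 0)" for u r
  define F' where "F' u r = (if u \<in> ?W then profile n u r else 0)" for u r
  have "(\<Sum>q\<in>level_perms n \<times> configurations n. \<bar>weight n (move n j q) - weight n q\<bar>)
      = (\<Sum>\<pi>\<in>level_perms n. \<Sum>c\<in>configurations n.
          \<bar>(\<Prod>u\<in>?W. F u (c u))\<^sup>2 - (\<Prod>u\<in>?W. F' u (c u))\<^sup>2\<bar> / real (card (level_perms n)))"
    unfolding sum.cartesian_product
    by (intro sum.cong) (auto simp: weight_def move_def prod_profile_move F_def F'_def simp flip: diff_divide_distrib)
  also have "\<dots> = (\<Sum>c\<in>configurations n. \<bar>(\<Prod>u\<in>?W. F u (c u))\<^sup>2 - (\<Prod>u\<in>?W. F' u (c u))\<^sup>2\<bar>)"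
    using level_perms_nonempty[of n] by (simp add: sum_divide_distrib[symmetric])
  also have "\<dots> \<le> 2 * sqrt (\<Sum>u\<in>?W. \<Sum>r<period. (F u r - F' u r)\<^sup>2)"
    unfolding configurations_def
    by (rule product_distribution_distance) (use finite_words bW n in \<open>auto simp: F_def F'_def profile_nonneg profile_unit\<close>)
  also have "(\<Sum>u\<in>?W. \<Sum>r<period. (F u r - F' u r)\<^sup>2)
      = (\<Sum>u\<in>?W. \<Sum>r<period. (profile n (?b u) r - profile n u r)\<^sup>2)"
    by (intro sum.cong) (auto simp: F_def F'_def)
  also have "\<dots> = (\<Sum>u\<in>?W. \<Sum>r<period. (profile n (?b (a j u)) r - profile n (a j u) r)\<^sup>2)"
    by (rule sum.reindex_bij_betw[OF a_bij_words, symmetric])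
  also have "\<dots> = (\<Sum>u\<in>?W. \<Sum>r<period. (profile n (a j u) r - profile n u r)\<^sup>2)"
  proof (rule sum.cong[OF refl])
    fix u assume "u \<in> ?W"
    then have "?b (a j u) = u"
      using a_bij_words[of j "Suc n"] by (intro inv_into_f_f) (auto simp: bij_betw_def)
    then show "(\<Sum>r<period. (profile n (?b (a j u)) r - profile n (a j u) r)\<^sup>2)
        = (\<Sum>r<period. (profile n (a j u) r - profile n u r)\<^sup>2)"
      by (simp add: power2_commute)
  qed
  also have "2 * sqrt \<dots> \<le> 2 * sqrt (2 * (real period + 1) * (real CARD('x))\<^sup>2 / real n)"
    using profile_energy[OF n] by (intro mult_left_mono real_sqrt_le_mono) auto
  finally show ?thesis .
qed

lemma generate_a: "generate G (range a) = carrier G"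
  unfolding G.generate_eq_words[OF a_in_G] carrier_G_words ..

text \<open>The means are the distributions of the retractions of random realizations. By \<open>realize_move\<close> and
  equivariance, translation by \<open>a j\<close> corresponds to \<open>move\<close>, which changes the distribution less and
  less as \<open>n\<close> grows.\<close>

theorem amenable_G: "amenable G"
proof -
  obtain R where R: "\<And>\<gamma>. \<gamma> \<in> eventually_injective \<Longrightarrow> R \<gamma> \<in> carrier G"
      "\<And>\<gamma> g. \<gamma> \<in> eventually_injective \<Longrightarrow> g \<in> carrier G \<Longrightarrow> R (\<gamma> \<circ> g) = R \<gamma> \<circ> g"
    using equivariant_retraction by blast
  let ?Q = "\<lambda>n. level_perms n \<times> configurations n"
  define f where "f n q = R (realize n q)" for n q
  \<comment> \<open>The index is shifted because the weights are normalized only for positive levels.\<close>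
  define m where "m n A = (\<Sum>q\<in>?Q (Suc n). if f (Suc n) q \<in> A then weight (Suc n) q else 0)" for n A
  have fin: "finite (?Q n)" for n
    using finite_level_perms finite_configurations by simp
  have f_in: "f n q \<in> carrier G" if "q \<in> ?Q n" for n q
    using that R(1) realize_eventually_injective by (auto simp: f_def)
  have nonneg: "weight n q \<ge> 0" for n q
    by (cases q) (simp add: weight_def)
  show ?thesis
  proof (rule G.amenableI_approximate_means[where S = "range a" and m = m])
    show "range a \<subseteq> carrier G" by auto
    show "generate G (range a) = carrier G" by (rule generate_a)
    show total: "m n (carrier G) = 1" for n
      using sum_weight[of "Suc n"] f_in[of _ "Suc n"] by (simp add: m_def cong: sum.cong)
    have "0 \<le> m n A" for n A
      using nonneg by (auto simp: m_def intro!: sum_nonneg)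
    moreover have "m n A \<le> m n (carrier G)" for n A
      unfolding m_def using nonneg f_in by (intro sum_mono) auto
    ultimately show "m n A \<in> {0..1}" for n A
      using total by (metis atLeastAtMost_iff)
    show "m n (A \<union> B) = m n A + m n B" if "A \<inter> B = {}" for n A B
      unfolding m_def sum.distrib[symmetric] using that by (intro sum.cong) auto
    show "(\<lambda>n. m n (s <#\<^bsub>G\<^esub> A) - m n A) \<longlonglongrightarrow> 0" if "s \<in> range a" "A \<subseteq> carrier G" for s A
    proof -
      obtain j where s: "s = a j" using \<open>s \<in> range a\<close> by blast
      have coset: "h \<circ> a j \<in> a j <#\<^bsub>G\<^esub> A \<longleftrightarrow> h \<in> A" for h
        using bij_is_surj[OF bij_G[OF a_in_G, of j]] by (auto simp: l_coset_def surj_fun_eq fun_eq_iff) (metis surjD ext)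
      have bound: "\<bar>m n (a j <#\<^bsub>G\<^esub> A) - m n A\<bar>
          \<le> 2 * sqrt (2 * (real period + 1) * (real CARD('x))\<^sup>2 / real (Suc n))" for n
      proof -
        let ?n = "Suc n"
        have "m n (a j <#\<^bsub>G\<^esub> A) = (\<Sum>q\<in>?Q ?n. if f ?n (move ?n j q) \<in> a j <#\<^bsub>G\<^esub> A then weight ?n (move ?n j q) else 0)"
          unfolding m_def by (rule sum.reindex_bij_betw[OF move_bij, symmetric])
        then have "\<bar>m n (a j <#\<^bsub>G\<^esub> A) - m n A\<bar>
           = \<bar>\<Sum>q\<in>?Q ?n. (if f ?n (move ?n j q) \<in> a j <#\<^bsub>G\<^esub> A then weight ?n (move ?n j q) else 0)
               - (if f ?n q \<in> A then weight ?n q else 0)\<bar>"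
          by (simp add: m_def sum_subtractf)
        also have "\<dots> \<le> (\<Sum>q\<in>?Q ?n. \<bar>(if f ?n (move ?n j q) \<in> a j <#\<^bsub>G\<^esub> A then weight ?n (move ?n j q) else 0)
               - (if f ?n q \<in> A then weight ?n q else 0)\<bar>)"
          by (rule sum_abs)
        also have "\<dots> \<le> (\<Sum>q\<in>?Q ?n. \<bar>weight ?n (move ?n j q) - weight ?n q\<bar>)"
        proof (rule sum_mono)
          fix q assume q: "q \<in> ?Q ?n"
          obtain \<pi> c where qe: "q = (\<pi>, c)" by (cases q)
          show "\<bar>(if f ?n (move ?n j q) \<in> a j <#\<^bsub>G\<^esub> A then weight ?n (move ?n j q) else 0)
               - (if f ?n q \<in> A then weight ?n q else 0)\<bar> \<le> \<bar>weight ?n (move ?n j q) - weight ?n q\<bar>"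
          proof (cases "\<forall>y. y \<noteq> j \<longrightarrow> c (replicate ?n j @ [y]) = 0")
            case True
            then have "realize ?n (move ?n j q) = realize ?n q \<circ> a j"
              unfolding qe by (intro realize_move) blast
            moreover have "realize ?n q \<in> eventually_injective"
              using q realize_eventually_injective by (simp add: qe)
            ultimately have "f ?n (move ?n j q) = f ?n q \<circ> a j"
              using R(2) by (simp add: f_def)
            then show ?thesis by (simp add: coset)
          next
            case False
            then obtain y where "y \<noteq> j" "c (replicate ?n j @ [y]) \<noteq> 0" by blast
            then have "weight ?n q = 0"
              unfolding qe by (intro weight_zero) simp_all
            \<comment> \<open>The image under the move may have positive weight, but this weight is then part of the bound.\<close>
            then show ?thesis using nonneg by simp
          qed
        qed
        also have "\<dots> \<le> 2 * sqrt (2 * (real period + 1) * (real CARD('x))\<^sup>2 / real ?n)"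
          by (rule weight_move_distance) simp
        finally show ?thesis .
      qed
      have "(\<lambda>n. 2 * sqrt (2 * (real period + 1) * (real CARD('x))\<^sup>2 / real (Suc n))) \<longlonglongrightarrow> 2 * sqrt 0"
        by (intro tendsto_intros lim_const_over_n[THEN LIMSEQ_Suc])
      then have "(\<lambda>n. 2 * sqrt (2 * (real period + 1) * (real CARD('x))\<^sup>2 / real (Suc n))) \<longlonglongrightarrow> 0"
        by simp
      then show ?thesis
        unfolding s by (rule Lim_null_comparison[rotated]) (use bound in auto)
    qed
  qed
qed

end

section \<open>Spinal Hanoi towers groups\<close>

theorem theorem1:
  fixes \<sigma> :: "'x::finite \<Rightarrow> 'x \<Rightarrow> 'x"
  assumes "\<And>i. bij (\<sigma> i)" and "\<And>i. \<sigma> i \<noteq> id" and "\<And>i. \<sigma> i i = i"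
  shows
    "(fractal (carrier (hanoi_group \<sigma>)) \<and> level_transitive (carrier (hanoi_group \<sigma>))
        \<longleftrightarrow> transitive_on (carrier (perm_group \<sigma>)) UNIV)
   \<and> (amenable (hanoi_group \<sigma>)
      \<and> contracting (carrier (hanoi_group \<sigma>))
      \<and> is_nucleus (carrier (hanoi_group \<sigma>))
          ({\<one>\<^bsub>hanoi_group \<sigma>\<^esub>} \<union>
           {hanoi_gen \<sigma> i [^]\<^bsub>hanoi_group \<sigma>\<^esub> r | i (r::nat). 1 \<le> r \<and> r < gen_ord \<sigma> i})
      \<and> (\<forall>\<gamma>. syllable_form (gen_ord \<sigma>) \<gamma> \<longrightarrow>
            is_identity_dom (\<sigma>, \<gamma>)
          \<and> (is_identity \<sigma> \<gamma> \<longleftrightarrow> word_elem \<sigma> \<gamma> = \<one>\<^bsub>hanoi_group \<sigma>\<^esub>)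
          \<and> (2 \<le> length \<gamma> \<and> word_perm \<sigma> \<gamma> = id \<longrightarrow>
              (\<forall>x. syllable_form (gen_ord \<sigma>) (section_word \<sigma> \<gamma> x)
                   \<and> length (section_word \<sigma> \<gamma> x) < length \<gamma>))))
   \<and> abelianization (hanoi_group \<sigma>) \<cong> product_group UNIV (\<lambda>i. integer_mod_group (gen_ord \<sigma> i))
   \<and> psi ` level_one_stabilizer (carrier (hanoi_group \<sigma>)) \<subseteq>
       {(gs, id) | gs. (\<forall>j. gs j \<in> carrier (hanoi_group \<sigma>)) \<and>
          (\<Otimes>\<^bsub>exponent_group \<sigma>\<^esub>j\<in>UNIV. eps \<sigma> (gs j))
            \<in> kernel (exponent_group \<sigma>) (abelianization (perm_group \<sigma>)) (lam \<sigma>)}"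
proof -
  interpret spinal_hanoi \<sigma>
    using assms by unfold_locales auto
  have nucleus: "{\<one>\<^bsub>G\<^esub>} \<union> {a i [^]\<^bsub>G\<^esub> r | i (r::nat). 1 \<le> r \<and> r < gen_ord \<sigma> i} = nucleus"
    by (simp add: nucleus_def)
  have contracting: "contracting (carrier G)"
    using self_similar_G contracting_to_nucleus unfolding contracting_def by blast
  have word_problem: "is_identity_dom (\<sigma>, \<gamma>)
      \<and> (is_identity \<sigma> \<gamma> \<longleftrightarrow> word_elem \<sigma> \<gamma> = \<one>\<^bsub>G\<^esub>)
      \<and> (2 \<le> length \<gamma> \<and> word_perm \<sigma> \<gamma> = id \<longrightarrow>
          (\<forall>x. syllable_form (gen_ord \<sigma>) (section_word \<sigma> \<gamma> x)
               \<and> length (section_word \<sigma> \<gamma> x) < length \<gamma>))"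
    if "syllable_form (gen_ord \<sigma>) \<gamma>" for \<gamma>
    unfolding G_one
    using is_identity_correct[OF that] section_word_shorter[OF that] syllable_form_section_word by blast
  have "abelianization G \<cong> product_group UNIV (\<lambda>i. integer_mod_group (gen_ord \<sigma> i))"
    using is_isoI[OF eps_bar_iso] by (simp add: exponent_group_def)
  then show ?thesis
    unfolding nucleus
    using fractal_level_transitive_iff amenable_G contracting is_nucleus_G word_problem
      psi_level_one_stabilizer
    by (intro conjI allI impI) blast+
qed

end
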